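(* Let $a,b,c,d\in\mathbb{R}$ be such that the matrix $\begin{pmatrix} a & b\\ c & d\end{pmatrix}$ is nonsingular. For every smooth compactly supported function $\psi:\mathbb{R}^3\to\mathbb{C}$ there is a constant $C_{\psi,a,b,c,d}$ (depending only on $\psi,a,b,c,d$) such that for all $\lambda>0$ and all $f\in L^4(\mathbb{R})$, $$\|\tilde T_\lambda^\psi f\|_{L^4(\mathbb{R}^2)}\le C_{\psi,a,b,c,d}\,\lambda^{-\frac38}\,\|f\|_{L^4(\mathbb{R})}.$$ Moreover this decay is sharp: if $\delta\in\mathbb{R}$ is such that for every smooth compactly supported $\psi$ there is a constant $C$ (depending on $\psi,a,b,c,d$) with $\|\tilde T_\lambda^\psi f\|_{L^4(\mathbb{R}^2)}\le C\lambda^{-\delta}\|f\|_{L^4(\mathbb{R})}$ for all $\lambda\ge1$ and all $f\in L^4(\mathbb{R})$, then $\delta\le\frac38$.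
   Context: For $\lambda>0$, $\psi:\mathbb{R}^3\to\mathbb{C}$ and real numbers $a,b,c,d$, the operator $\tilde T_\lambda^\psi$ is $$\tilde T_\lambda^\psi f(x,y)=\int_{\mathbb{R}}e^{i\lambda[(ax+by)t^2+(cx+dy)^2t]}\psi(x,y,t)f(t)\,dt,\qquad (x,y)\in\mathbb{R}^2.$$ *)

theory Defs
  imports "HOL-Analysis.Analysis"
begin

primrec Ck :: "nat \<Rightarrow> ('a::euclidean_space \<Rightarrow> 'b::real_normed_vector) \<Rightarrow> bool" where
  "Ck 0 f \<longleftrightarrow> continuous_on UNIV f"
| "Ck (Suc k) f \<longleftrightarrow>
     (\<forall>x. f differentiable (at x)) \<and> (\<forall>v. Ck k (\<lambda>x. frechet_derivative f (at x) v))"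

definition smooth :: "('a::euclidean_space \<Rightarrow> 'b::real_normed_vector) \<Rightarrow> bool" where
  "smooth f \<longleftrightarrow> (\<forall>k. Ck k f)"

definition compactly_supported :: "('a::euclidean_space \<Rightarrow> 'b::real_normed_vector) \<Rightarrow> bool" where
  "compactly_supported f \<longleftrightarrow> compact (closure {x. f x \<noteq> 0})"

text \<open>
  Lebesgue spaces for finite exponents, with respect to the completed Lebesgue measure and in
  terms of functions rather than classes modulo null sets. The value of \<open>Lp_norm\<close> is
  meaningful only on \<open>Lp_space\<close>: the Bochner integral of a non-integrable function is 0, so
  a norm bound has to be accompanied by membership in \<open>Lp_space\<close>.
\<close>

definition Lp_space :: "real \<Rightarrow> ('a::euclidean_space \<Rightarrow> complex) set" where
  "Lp_space p = {f \<in> borel_measurable lebesgue. integrable lebesgue (\<lambda>x. cmod (f x) powr p)}"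

definition Lp_norm :: "real \<Rightarrow> ('a::euclidean_space \<Rightarrow> complex) \<Rightarrow> real" where
  "Lp_norm p f = (\<integral>x. cmod (f x) powr p \<partial>lebesgue) powr (1 / p)"

definition T_op :: "real \<Rightarrow> real \<Rightarrow> real \<Rightarrow> real \<Rightarrow> (real \<times> real \<times> real \<Rightarrow> complex) \<Rightarrow> real
    \<Rightarrow> (real \<Rightarrow> complex) \<Rightarrow> real \<times> real \<Rightarrow> complex" where
  "T_op a b c d \<psi> lam f = (\<lambda>(x, y).
     \<integral>t. exp (\<i> * complex_of_real (lam * ((a * x + b * y) * t\<^sup>2 + (c * x + d * y)\<^sup>2 * t)))
         * \<psi> (x, y, t) * f t \<partial>lebesgue)"

end

theory Submission
  imports Defs "HOL-Probability.Probability"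
begin

text \<open>
  In the coordinates \<open>u = a x + b y\<close>, \<open>v = c x + d y\<close> the phase is \<open>\<lambda> (u t\<^sup>2 + v\<^sup>2 t)\<close>. Writing the
  amplitude as an integral of its mixed derivative \<open>\<partial>\<^sub>u \<partial>\<^sub>v \<psi>\<close> against indicators of quadrants removes the
  dependence on \<open>u, v\<close>; since only \<open>|T f|\<^sup>4 \<ge> 0\<close> is integrated, the sharp cutoff in \<open>u\<close> may then be replaced
  by a Gaussian. Expanding \<open>|T f|\<^sup>4\<close> gives a quadrilinear form in \<open>f\<close> whose kernel is at most
  \<open>exp (- (\<lambda> p)\<^sup>2 / 2) (\<lambda> |q|)\<^sup>-\<^sup>1\<^sup>/\<^sup>2\<close>, where \<open>p = t\<^sub>1\<^sup>2 + t\<^sub>2\<^sup>2 - s\<^sub>1\<^sup>2 - s\<^sub>2\<^sup>2\<close> and \<open>q = t\<^sub>1 + t\<^sub>2 - s\<^sub>1 - s\<^sub>2\<close>. No further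
  cancellation is needed: the integral of this positive kernel over any three of the four variables is
  \<open>O(\<lambda>\<^sup>-\<^sup>3\<^sup>/\<^sup>2)\<close>, and the arithmetic-geometric mean inequality concludes.

  For the sharpness take \<open>f\<close> to be the indicator of \<open>[0, 1]\<close>: there is no oscillation where
  \<open>|u| \<le> 1 / (2 \<lambda>)\<close> and \<open>v\<^sup>2 \<le> 1 / (2 \<lambda>)\<close>, a set of measure comparable to \<open>\<lambda>\<^sup>-\<^sup>3\<^sup>/\<^sup>2\<close>.
\<close>

section \<open>The positive kernel\<close>

text \<open>The power \<open>lam powr (-3/2)\<close> has two sources: the Gaussian in p contributes
  1 / lam, and the stationary point v = 0 of the phase v^2 q contributes lam^(-1/2). The fourth root
  of the total gives 3/8. The sharp cutoff in u has to go before absolute values are taken inside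
  the quadrilinear form. Its Fourier transform at lam p is only of size min(1, 1 / (lam |p|)), and
  integrating that over a bounded range of p costs a factor log lam; the Gaussian decays integrably.
  The cutoff in v may stay sharp, because the Fresnel integral over [-R, R] is O((lam |q|)^(-1/2))
  uniformly in R. The amplitude is the other obstacle, since it would enter the integral over (u, v)
  that produces the kernel. After the quadrant representation it splits into functions of t, which
  are absorbed into f, and cutoffs in (u, v), which lie between 0 and 1 and are dropped once the
  modulus is taken.\<close>

lemma nn_integral_abs_powr_finite:
  fixes s M :: real
  assumes "s < 1" "0 \<le> M"
  shows "(\<integral>\<^sup>+x. ennreal (indicator {-M..M} x * \<bar>x\<bar> powr (-s)) \<partial>lborel) < \<infinity>"
proof -
  have *: "(\<integral>\<^sup>+x. ennreal (indicator {0..M} x * x powr (-s)) \<partial>lborel) < \<infinity>"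
    using nn_integral_has_integral_lebesgue[OF _ has_integral_powr_from_0[of "-s" M]] assms by simp
  have "(\<integral>\<^sup>+x. ennreal (indicator {-M..M} x * \<bar>x\<bar> powr (-s)) \<partial>lborel)
     \<le> (\<integral>\<^sup>+x. ennreal (indicator {0..M} x * x powr (-s)) + ennreal (indicator {0..M} (-x) * (-x) powr (-s)) \<partial>lborel)"
    by (intro nn_integral_mono) (auto simp: indicator_def)
  also have "\<dots> = (\<integral>\<^sup>+x. ennreal (indicator {0..M} x * x powr (-s)) \<partial>lborel)
       + (\<integral>\<^sup>+x. ennreal (indicator {0..M} (-x) * (-x) powr (-s)) \<partial>lborel)"
    by (intro nn_integral_add) auto
  also have "(\<integral>\<^sup>+x. ennreal (indicator {0..M} (-x) * (-x) powr (-s)) \<partial>lborel)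
       = (\<integral>\<^sup>+x. ennreal (indicator {0..M} x * x powr (-s)) \<partial>lborel)"
    using nn_integral_real_affine[of "\<lambda>x. ennreal (indicator {0..M} x * x powr (-s))" "-1" 0] by simp
  finally show ?thesis using * by (auto simp: less_top[symmetric] top_unique)
qed

lemma nn_integral_gaussian_affine:
  fixes \<alpha> \<beta> :: real
  assumes "\<alpha> \<noteq> 0"
  shows "(\<integral>\<^sup>+x. ennreal (exp (- (\<alpha> * x + \<beta>)\<^sup>2 / 2)) \<partial>lborel) = ennreal (sqrt (2 * pi) / \<bar>\<alpha>\<bar>)"
proof -
  let ?g = "\<lambda>x::real. ennreal (exp (- x\<^sup>2 / 2))"
  interpret prob_space "density lborel std_normal_density" by (rule prob_space_normal_density) simp
  have "1 = (\<integral>\<^sup>+x. ennreal (std_normal_density x) \<partial>lborel)"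
    using emeasure_space_1 by (simp add: emeasure_density)
  also have "\<dots> = (\<integral>\<^sup>+x. ennreal (1 / sqrt (2 * pi)) * ?g x \<partial>lborel)"
    by (intro nn_integral_cong) (simp add: std_normal_density_def flip: ennreal_mult')
  also have "\<dots> = ennreal (1 / sqrt (2 * pi)) * (\<integral>\<^sup>+x. ?g x \<partial>lborel)"
    by (rule nn_integral_cmult) simp
  finally have "ennreal (sqrt (2 * pi)) * 1 = ennreal (sqrt (2 * pi)) * (ennreal (1 / sqrt (2 * pi)) * (\<integral>\<^sup>+x. ?g x \<partial>lborel))"
    by simp
  also have "\<dots> = (\<integral>\<^sup>+x. ?g x \<partial>lborel)"
    by (simp add: mult.assoc[symmetric] flip: ennreal_mult')
  also have "\<dots> = \<bar>\<alpha>\<bar> * (\<integral>\<^sup>+x. ?g (\<beta> + \<alpha> * x) \<partial>lborel)"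
    using assms by (intro nn_integral_real_affine) auto
  finally have "ennreal (1 / \<bar>\<alpha>\<bar>) * ennreal (sqrt (2 * pi)) = ennreal (1 / \<bar>\<alpha>\<bar>) * (\<bar>\<alpha>\<bar> * (\<integral>\<^sup>+x. ?g (\<beta> + \<alpha> * x) \<partial>lborel))"
    by simp
  also have "\<dots> = (\<integral>\<^sup>+x. ?g (\<beta> + \<alpha> * x) \<partial>lborel)"
    using assms by (simp add: mult.assoc[symmetric] flip: ennreal_mult')
  finally show ?thesis by (simp add: add.commute flip: ennreal_mult')
qed

text \<open>Decay of order 1 / y is all that the Gaussian has to supply where p stays away from 0:
  with y = lam |m| it already yields the factor 1 / lam.\<close>

lemma exp_neg_square_le:
  fixes y :: real assumes "0 < y"
  shows "exp (- y\<^sup>2 / 8) \<le> 2 / y"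
proof -
  have "exp (- y\<^sup>2 / 8) = 1 / exp (y\<^sup>2 / 8)" by (simp add: exp_minus field_simps)
  also have "\<dots> \<le> 1 / (1 + y\<^sup>2 / 8)" by (intro divide_left_mono) (auto intro!: mult_pos_pos add_pos_nonneg)
  also have "\<dots> \<le> 2 / y"
  proof -
    have "0 \<le> (y - 2)\<^sup>2" by simp
    then have "y \<le> 2 * (1 + y\<^sup>2 / 8)" by (simp add: power2_eq_square algebra_simps)
    then show ?thesis using assms by (simp add: divide_simps add_pos_nonneg)
  qed
  finally show ?thesis .
qed

text \<open>On a bounded range of B the integral is at most of order 1 / (lam max(|A|, |m|)), hence
  at most a weighted geometric mean of 1 / |A| and 1 / |m|, up to the factor 1 / lam. The weight
  theta = 1/8 on m is one choice in 0 < theta < 1/4: the lower limit keeps |A|^(theta - 1)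
  integrable at 0, and the upper one keeps the remaining singularity in q, of order 1/2 + 2 theta
  when t1 = 0, integrable.\<close>

lemma gaussian_hyperbola_integral_le:
  fixes R lam A m :: real
  assumes R: "1 \<le> R" and lam: "0 < lam" and A: "A \<noteq> 0" and m: "m \<noteq> 0"
  shows "(\<integral>\<^sup>+B. ennreal (indicator {-6*R..6*R} B * exp (- (lam * (2 * A * B + m))\<^sup>2 / 2)) \<partial>lborel)
    \<le> ennreal (48 * R / lam * (\<bar>A\<bar> powr (-7/8) * \<bar>m\<bar> powr (-1/8)))"
proof (cases "24 * R * \<bar>A\<bar> \<le> \<bar>m\<bar>")
  \<comment> \<open>For |B| <= 6 R the term 2 A B is at most 12 R |A| <= |m| / 2, so the exponent is
    bounded away from 0. Below the threshold the Gaussian is integrated over the whole line, which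
    gives a multiple of 1 / (lam |A|).\<close>
  case True
  have le: "ennreal (indicator {-6*R..6*R} B * exp (- (lam * (2 * A * B + m))\<^sup>2 / 2))
      \<le> ennreal (2 / (lam * \<bar>m\<bar>)) * indicator {-6*R..6*R} B" for B
  proof (cases "B \<in> {-6*R..6*R}")
    case B: True
    have "\<bar>2 * A * B\<bar> \<le> 2 * \<bar>A\<bar> * (6 * R)"
      unfolding abs_mult using B R by (intro mult_mono) auto
    moreover have "2 * \<bar>A\<bar> * (6 * R) = 24 * R * \<bar>A\<bar> / 2" by simp
    ultimately have "\<bar>m\<bar> / 2 \<le> \<bar>2 * A * B + m\<bar>" using True by linarith
    then have "(lam * (\<bar>m\<bar> / 2))\<^sup>2 \<le> (lam * \<bar>2 * A * B + m\<bar>)\<^sup>2"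
      using lam by (intro power_mono mult_left_mono) auto
    then have "exp (- (lam * (2 * A * B + m))\<^sup>2 / 2) \<le> exp (- (lam * \<bar>m\<bar>)\<^sup>2 / 8)"
      by (simp add: power_mult_distrib power_divide)
    also have "\<dots> \<le> 2 / (lam * \<bar>m\<bar>)" using lam m by (intro exp_neg_square_le) auto
    finally show ?thesis using B by (simp add: ennreal_leI)
  qed simp
  have "(\<integral>\<^sup>+B. ennreal (indicator {-6*R..6*R} B * exp (- (lam * (2 * A * B + m))\<^sup>2 / 2)) \<partial>lborel)
    \<le> (\<integral>\<^sup>+B. ennreal (2 / (lam * \<bar>m\<bar>)) * indicator {-6*R..6*R} B \<partial>lborel)"
    by (intro nn_integral_mono le)
  also have "\<dots> = ennreal (2 / (lam * \<bar>m\<bar>)) * ennreal (12 * R)"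
    using R by (subst nn_integral_cmult_indicator) auto
  also have "\<dots> = ennreal (24 * R / lam * (1 / \<bar>m\<bar>))"
    using R lam by (simp flip: ennreal_mult')
  also have "\<dots> \<le> ennreal (48 * R / lam * (\<bar>A\<bar> powr (-7/8) * \<bar>m\<bar> powr (-1/8)))"
  proof (intro ennreal_leI mult_mono)
    have "1 / \<bar>m\<bar> = \<bar>m\<bar> powr (-7/8) * \<bar>m\<bar> powr (-1/8)"
      using m by (simp add: powr_add[symmetric] powr_minus_divide)
    also have "\<dots> \<le> \<bar>A\<bar> powr (-7/8) * \<bar>m\<bar> powr (-1/8)"
    proof (intro mult_right_mono powr_mono2')
      have "1 * \<bar>A\<bar> \<le> 24 * R * \<bar>A\<bar>" using R by (intro mult_right_mono) auto
      then show "\<bar>A\<bar> \<le> \<bar>m\<bar>" using True by simp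
    qed (use A in auto)
    finally show "1 / \<bar>m\<bar> \<le> \<bar>A\<bar> powr (-7/8) * \<bar>m\<bar> powr (-1/8)" .
    show "24 * R / lam \<le> 48 * R / lam" using R lam by (simp add: divide_right_mono)
  qed (use R lam in auto)
  finally show ?thesis .
next
  case False
  have "(\<integral>\<^sup>+B. ennreal (indicator {-6*R..6*R} B * exp (- (lam * (2 * A * B + m))\<^sup>2 / 2)) \<partial>lborel)
    \<le> (\<integral>\<^sup>+B. ennreal (exp (- (2 * lam * A * B + lam * m)\<^sup>2 / 2)) \<partial>lborel)"
    by (intro nn_integral_mono) (auto simp: indicator_def algebra_simps)
  also have "\<dots> = ennreal (sqrt (2 * pi) / \<bar>2 * lam * A\<bar>)"
    using lam A by (intro nn_integral_gaussian_affine) auto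
  also have "\<dots> = ennreal (sqrt (2 * pi) / 2 / lam * (1 / \<bar>A\<bar>))"
    using lam by (simp add: abs_mult)
  also have "\<dots> \<le> ennreal (2 / lam * (24 * R * (\<bar>A\<bar> powr (-7/8) * \<bar>m\<bar> powr (-1/8))))"
  proof (intro ennreal_leI mult_mono)
    have "sqrt (2 * pi) \<le> 4" using pi_less_4 by (intro real_le_lsqrt) auto
    then show "sqrt (2 * pi) / 2 / lam \<le> 2 / lam" using lam by (intro divide_right_mono) auto
    have "1 / \<bar>A\<bar> = \<bar>A\<bar> powr (-7/8) * \<bar>A\<bar> powr (-1/8)"
      using A by (simp add: powr_add[symmetric] powr_minus_divide)
    also have "\<dots> \<le> \<bar>A\<bar> powr (-7/8) * (\<bar>m\<bar> / (24 * R)) powr (-1/8)"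
      using False R m by (intro mult_left_mono powr_mono2') (auto simp: field_simps)
    also have "(\<bar>m\<bar> / (24 * R)) powr (-1/8) = \<bar>m\<bar> powr (-1/8) * (24 * R) powr (1/8)"
      using R by (simp add: powr_divide powr_minus_divide)
    also have "\<bar>A\<bar> powr (-7/8) * (\<bar>m\<bar> powr (-1/8) * (24 * R) powr (1/8)) \<le> \<bar>A\<bar> powr (-7/8) * (\<bar>m\<bar> powr (-1/8) * (24 * R) powr 1)"
      using R by (intro mult_left_mono powr_mono) auto
    finally show "1 / \<bar>A\<bar> \<le> 24 * R * (\<bar>A\<bar> powr (-7/8) * \<bar>m\<bar> powr (-1/8))"
      using R by (simp add: mult_ac)
  qed (use lam in auto)
  also have "\<dots> = ennreal (48 * R / lam * (\<bar>A\<bar> powr (-7/8) * \<bar>m\<bar> powr (-1/8)))"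
    by (simp add: algebra_simps)
  finally show ?thesis .
qed

text \<open>
  The case \<open>q = 0\<close> is separated because \<open>4 / sqrt 0\<close> is 0, whereas the integral that this factor has to
  bound (\<open>fresnel_bound\<close>) equals \<open>2 * R\<close> there.
\<close>

definition hkernel :: "real \<Rightarrow> real \<Rightarrow> real \<Rightarrow> real \<Rightarrow> real" where
  "hkernel R lam p q = exp (- (lam * p)\<^sup>2 / 2) * (if q = 0 then 2 * R else 4 / sqrt (lam * \<bar>q\<bar>))"

lemma hkernel_measurable [measurable]:
  assumes [measurable]: "f \<in> borel_measurable M" "g \<in> borel_measurable M"
  shows "(\<lambda>x. hkernel R lam (f x) (g x)) \<in> borel_measurable M"
  unfolding hkernel_def by measurable

lemma hkernel_nonneg: "0 \<le> R \<Longrightarrow> 0 < lam \<Longrightarrow> 0 \<le> hkernel R lam p q"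
  by (auto simp: hkernel_def)

text \<open>
  With \<open>q\<close> in place of \<open>t\<^sub>2\<close> and \<open>A = s\<^sub>1 - t\<^sub>1 + q\<close>, \<open>B = s\<^sub>2 - t\<^sub>1 + q\<close> the quadratic form becomes
  \<open>p = 2 A B + q (2 t\<^sub>1 - q)\<close>. Integrating \<open>B\<close> and then \<open>A\<close> leaves the integrable singularity
  \<open>|q|\<^sup>-\<^sup>5\<^sup>/\<^sup>8 |2 t\<^sub>1 - q|\<^sup>-\<^sup>1\<^sup>/\<^sup>8\<close>.
\<close>

lemma triple_integral_kernel_bound:
  fixes R :: real
  assumes R: "1 \<le> R"
  obtains B where "0 \<le> B" "\<And>lam t1. 0 < lam \<Longrightarrow> \<bar>t1\<bar> \<le> R \<Longrightarrow>
     (\<integral>\<^sup>+s1. (\<integral>\<^sup>+s2. (\<integral>\<^sup>+t2. ennreal (indicator {-R..R} s1 * indicator {-R..R} s2 * indicator {-R..R} t2 *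
        hkernel R lam (t1\<^sup>2 + t2\<^sup>2 - (s1\<^sup>2 + s2\<^sup>2)) (t1 + t2 - (s1 + s2))) \<partial>lborel) \<partial>lborel) \<partial>lborel)
     \<le> ennreal (B * lam powr (-3/2))"
proof -
  \<comment> \<open>With all four variables in [-R, R] one has |q| <= 4 R, so A, B and 2 t1 - q all
    lie in [-6 R, 6 R]. The powers -7/8 and -3/4 are those met in A and in q.\<close>
  obtain c1 where c1: "(\<integral>\<^sup>+x. ennreal (indicator {-6*R..6*R} x * \<bar>x\<bar> powr (-7/8)) \<partial>lborel) = ennreal c1" "0 \<le> c1"
    using nn_integral_abs_powr_finite[of "7/8" "6*R"] R
    by (cases "\<integral>\<^sup>+x. ennreal (indicator {-6*R..6*R} x * \<bar>x\<bar> powr (-7/8)) \<partial>lborel" rule: ennreal_cases) auto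
  obtain c2 where c2: "(\<integral>\<^sup>+x. ennreal (indicator {-6*R..6*R} x * \<bar>x\<bar> powr (-3/4)) \<partial>lborel) = ennreal c2" "0 \<le> c2"
    using nn_integral_abs_powr_finite[of "3/4" "6*R"] R
    by (cases "\<integral>\<^sup>+x. ennreal (indicator {-6*R..6*R} x * \<bar>x\<bar> powr (-3/4)) \<partial>lborel" rule: ennreal_cases) auto
  \<comment> \<open>192 = 4 * 48 combines the constants of \<open>hkernel\<close> and
    \<open>gaussian_hyperbola_integral_le\<close>; \<open>2 * c2\<close> is the integral of the two
    summands of \<open>?g\<close> below.\<close>
  define B where "B = 192 * R * c1 * (2 * c2)"
  show thesis
  proof
    show "0 \<le> B" using R c1 c2 by (simp add: B_def)
  next
    fix lam t1 :: real
    assume lam: "0 < lam" and t1: "\<bar>t1\<bar> \<le> R"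
    let ?I = "\<lambda>s. indicator {-R..R} s :: real" and ?J = "\<lambda>s. indicator {-6*R..6*R} s :: real"
    let ?\<Phi> = "\<lambda>s1 s2 t2. ennreal (?I s1 * ?I s2 * ?I t2 *
        hkernel R lam (t1\<^sup>2 + t2\<^sup>2 - (s1\<^sup>2 + s2\<^sup>2)) (t1 + t2 - (s1 + s2)))"
    \<comment> \<open>In |q|^(-5/8) |2 t1 - q|^(-1/8), replacing the larger of the two moduli by the
      smaller leaves the power -3/4 of the smaller one. The sum of both candidates dominates it, and
      its integral is the same for every t1.\<close>
    let ?g = "\<lambda>q. ?J q * \<bar>q\<bar> powr (-3/4) + ?J (2 * t1 - q) * \<bar>2 * t1 - q\<bar> powr (-3/4)"
    \<comment> \<open>The two excluded values of q are the zeros of m = q (2 t1 - q), where the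
      bound in A and B breaks down. They form a null set, so the integral over q ignores
      them.\<close>
    have inner: "(\<integral>\<^sup>+A. (\<integral>\<^sup>+B. ?\<Phi> (A + (t1 - q)) (B + (t1 - q)) (q + (A + (t1 - q) + (B + (t1 - q)) - t1)) \<partial>lborel) \<partial>lborel)
        \<le> ennreal (192 * R * lam powr (-3/2) * c1 * ?g q)" if q: "q \<noteq> 0" "q \<noteq> 2 * t1" for q
    proof (cases "\<bar>q\<bar> \<le> 4 * R")
      case False
      have "?\<Phi> (A + (t1 - q)) (B + (t1 - q)) (q + (A + (t1 - q) + (B + (t1 - q)) - t1)) = 0" for A B
        using t1 False by (auto simp: indicator_def)
      then show ?thesis by simp
    next
      case True
      define m where "m = q * (2 * t1 - q)"
      have m: "m \<noteq> 0" using q by (auto simp: m_def)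
      let ?w = "4 / sqrt (lam * \<bar>q\<bar>)"
      have "?\<Phi> (A + (t1 - q)) (B + (t1 - q)) (q + (A + (t1 - q) + (B + (t1 - q)) - t1))
         \<le> ennreal (?w * ?J A) * ennreal (?J B * exp (- (lam * (2 * A * B + m))\<^sup>2 / 2))" for A B
      proof -
        have q': "t1 + (q + (A + (t1 - q) + (B + (t1 - q)) - t1)) - (A + (t1 - q) + (B + (t1 - q))) = q" by simp
        have p': "t1\<^sup>2 + (q + (A + (t1 - q) + (B + (t1 - q)) - t1))\<^sup>2 - ((A + (t1 - q))\<^sup>2 + (B + (t1 - q))\<^sup>2) = 2 * A * B + m"
          by (simp add: m_def power2_eq_square algebra_simps)
        have "?I (A + (t1 - q)) \<le> ?J A" "?I (B + (t1 - q)) \<le> ?J B"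
          using t1 True by (auto simp: indicator_def)
        then have "?I (A + (t1 - q)) * ?I (B + (t1 - q)) * ?I (q + (A + (t1 - q) + (B + (t1 - q)) - t1)) \<le> ?J A * ?J B * 1"
          by (intro mult_mono) (auto simp: indicator_def)
        then have "?I (A + (t1 - q)) * ?I (B + (t1 - q)) * ?I (q + (A + (t1 - q) + (B + (t1 - q)) - t1)) * hkernel R lam (2 * A * B + m) q
           \<le> ?J A * ?J B * 1 * hkernel R lam (2 * A * B + m) q"
          using R lam by (intro mult_right_mono hkernel_nonneg) auto
        also have "\<dots> = (?w * ?J A) * (?J B * exp (- (lam * (2 * A * B + m))\<^sup>2 / 2))"
          using q by (simp add: hkernel_def)
        finally show ?thesis unfolding q' p' using lam by (subst ennreal_mult[symmetric]) (auto intro!: ennreal_leI)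
      qed
      then have "(\<integral>\<^sup>+A. (\<integral>\<^sup>+B. ?\<Phi> (A + (t1 - q)) (B + (t1 - q)) (q + (A + (t1 - q) + (B + (t1 - q)) - t1)) \<partial>lborel) \<partial>lborel)
         \<le> (\<integral>\<^sup>+A. (\<integral>\<^sup>+B. ennreal (?w * ?J A) * ennreal (?J B * exp (- (lam * (2 * A * B + m))\<^sup>2 / 2)) \<partial>lborel) \<partial>lborel)"
        by (intro nn_integral_mono)
      also have "\<dots> = (\<integral>\<^sup>+A. ennreal (?w * ?J A) * (\<integral>\<^sup>+B. ennreal (?J B * exp (- (lam * (2 * A * B + m))\<^sup>2 / 2)) \<partial>lborel) \<partial>lborel)"
        by (intro nn_integral_cong nn_integral_cmult) auto
      also have "\<dots> \<le> (\<integral>\<^sup>+A. ennreal (?w * ?J A) * ennreal (48 * R / lam * (\<bar>A\<bar> powr (-7/8) * \<bar>m\<bar> powr (-1/8))) \<partial>lborel)"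
        by (intro nn_integral_mono_AE AE_I[of _ _ "{0}"])
           (auto intro!: mult_left_mono gaussian_hyperbola_integral_le[OF R lam _ m, simplified])
      also have "\<dots> = (\<integral>\<^sup>+A. ennreal (?w * (48 * R / lam) * \<bar>m\<bar> powr (-1/8)) * ennreal (?J A * \<bar>A\<bar> powr (-7/8)) \<partial>lborel)"
        using R lam by (intro nn_integral_cong) (simp add: mult_ac flip: ennreal_mult')
      also have "\<dots> = ennreal (?w * (48 * R / lam) * \<bar>m\<bar> powr (-1/8)) * ennreal c1"
        using c1 by (subst nn_integral_cmult) auto
      also have "\<dots> = ennreal (?w * (48 * R / lam) * \<bar>m\<bar> powr (-1/8) * c1)"
        using R lam by (simp flip: ennreal_mult')
      also have "\<dots> \<le> ennreal (192 * R * lam powr (-3/2) * c1 * ?g q)"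
      proof (intro ennreal_leI)
        define x y where "x = \<bar>q\<bar>" and "y = \<bar>2 * t1 - q\<bar>"
        have xy: "0 < x" "0 < y" using q by (auto simp: x_def y_def)
        have "x powr (-5/8) * y powr (-1/8) \<le> x powr (-3/4) + y powr (-3/4)"
        proof (cases "x \<le> y")
          case True
          then have "x powr (-5/8) * y powr (-1/8) \<le> x powr (-5/8) * x powr (-1/8)"
            using xy by (intro mult_left_mono powr_mono2') auto
          also have "\<dots> = x powr (-3/4)" by (simp add: powr_add[symmetric])
          finally show ?thesis by (simp add: add_increasing2)
        next
          case False
          then have "x powr (-5/8) * y powr (-1/8) \<le> y powr (-5/8) * y powr (-1/8)"
            using xy by (intro mult_right_mono powr_mono2') auto
          also have "\<dots> = y powr (-3/4)" by (simp add: powr_add[symmetric])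
          finally show ?thesis by (simp add: add_increasing)
        qed
        also have "\<dots> = ?g q"
          using True t1 by (auto simp: x_def y_def indicator_def)
        finally have *: "x powr (-5/8) * y powr (-1/8) \<le> ?g q" .
        have "?w * (48 * R / lam) * \<bar>m\<bar> powr (-1/8) * c1
          = 192 * R * (1 / (sqrt lam * lam)) * c1 * ((1 / sqrt x) * (x powr (-1/8) * y powr (-1/8)))"
          by (simp add: m_def abs_mult powr_mult real_sqrt_mult x_def y_def mult_ac)
        also have "1 / (sqrt lam * lam) = lam powr (-3/2)"
          using lam powr_add[of lam "1/2" 1] by (simp add: powr_half_sqrt powr_minus_divide)
        also have "(1 / sqrt x) * (x powr (-1/8) * y powr (-1/8)) = x powr (-5/8) * y powr (-1/8)"
        proof -
          have "1 / sqrt x = x powr (-1/2)" using xy by (simp add: powr_half_sqrt[symmetric] powr_minus_divide)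
          then show ?thesis by (simp add: powr_add[symmetric] flip: mult.assoc)
        qed
        also have "192 * R * lam powr (-3/2) * c1 * (x powr (-5/8) * y powr (-1/8)) \<le> 192 * R * lam powr (-3/2) * c1 * ?g q"
          using R c1 by (intro mult_left_mono *) auto
        finally show "?w * (48 * R / lam) * \<bar>m\<bar> powr (-1/8) * c1 \<le> 192 * R * lam powr (-3/2) * c1 * ?g q" .
      qed
      finally show ?thesis .
    qed
    \<comment> \<open>The variable q replaces the innermost t2 and is then moved outermost. With q
      fixed, passing from s1, s2 to A, B is a translation by t1 - q in each variable, so every
      substitution has Jacobian 1.\<close>
    have "(\<integral>\<^sup>+s1. (\<integral>\<^sup>+s2. (\<integral>\<^sup>+t2. ?\<Phi> s1 s2 t2 \<partial>lborel) \<partial>lborel) \<partial>lborel)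
       = (\<integral>\<^sup>+s1. (\<integral>\<^sup>+s2. (\<integral>\<^sup>+q. ?\<Phi> s1 s2 (q + (s1 + s2 - t1)) \<partial>lborel) \<partial>lborel) \<partial>lborel)"
    proof (rule nn_integral_cong, rule nn_integral_cong)
      fix s1 s2 :: real
      show "(\<integral>\<^sup>+t2. ?\<Phi> s1 s2 t2 \<partial>lborel) = (\<integral>\<^sup>+q. ?\<Phi> s1 s2 (q + (s1 + s2 - t1)) \<partial>lborel)"
        using nn_integral_real_affine[of "?\<Phi> s1 s2" 1 "s1 + s2 - t1"] by (simp add: add.commute)
    qed
    also have "\<dots> = (\<integral>\<^sup>+s1. (\<integral>\<^sup>+q. (\<integral>\<^sup>+s2. ?\<Phi> s1 s2 (q + (s1 + s2 - t1)) \<partial>lborel) \<partial>lborel) \<partial>lborel)"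
      by (rule nn_integral_cong, rule lborel_pair.Fubini', measurable)
    also have "\<dots> = (\<integral>\<^sup>+q. (\<integral>\<^sup>+s1. (\<integral>\<^sup>+s2. ?\<Phi> s1 s2 (q + (s1 + s2 - t1)) \<partial>lborel) \<partial>lborel) \<partial>lborel)"
      by (rule lborel_pair.Fubini', measurable)
    also have "\<dots> = (\<integral>\<^sup>+q. (\<integral>\<^sup>+A. (\<integral>\<^sup>+s2. ?\<Phi> (A + (t1 - q)) s2 (q + (A + (t1 - q) + s2 - t1)) \<partial>lborel) \<partial>lborel) \<partial>lborel)"
    proof (rule nn_integral_cong)
      fix q :: real
      have "(\<lambda>s1. \<integral>\<^sup>+s2. ?\<Phi> s1 s2 (q + (s1 + s2 - t1)) \<partial>lborel) \<in> borel_measurable borel"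
        by measurable
      from nn_integral_real_affine[OF this, of 1 "t1 - q"]
      show "(\<integral>\<^sup>+s1. (\<integral>\<^sup>+s2. ?\<Phi> s1 s2 (q + (s1 + s2 - t1)) \<partial>lborel) \<partial>lborel)
        = (\<integral>\<^sup>+A. (\<integral>\<^sup>+s2. ?\<Phi> (A + (t1 - q)) s2 (q + (A + (t1 - q) + s2 - t1)) \<partial>lborel) \<partial>lborel)"
        by (simp add: add.commute)
    qed
    also have "\<dots> = (\<integral>\<^sup>+q. (\<integral>\<^sup>+A. (\<integral>\<^sup>+B. ?\<Phi> (A + (t1 - q)) (B + (t1 - q)) (q + (A + (t1 - q) + (B + (t1 - q)) - t1)) \<partial>lborel) \<partial>lborel) \<partial>lborel)"
    proof (rule nn_integral_cong, rule nn_integral_cong)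
      fix q A :: real
      show "(\<integral>\<^sup>+s2. ?\<Phi> (A + (t1 - q)) s2 (q + (A + (t1 - q) + s2 - t1)) \<partial>lborel)
        = (\<integral>\<^sup>+B. ?\<Phi> (A + (t1 - q)) (B + (t1 - q)) (q + (A + (t1 - q) + (B + (t1 - q)) - t1)) \<partial>lborel)"
        using nn_integral_real_affine[of "\<lambda>s2. ?\<Phi> (A + (t1 - q)) s2 (q + (A + (t1 - q) + s2 - t1))" 1 "t1 - q"]
        by (simp add: add.commute)
    qed
    also have "\<dots> \<le> (\<integral>\<^sup>+q. ennreal (192 * R * lam powr (-3/2) * c1 * ?g q) \<partial>lborel)"
      by (intro nn_integral_mono_AE AE_I[of _ _ "{0, 2 * t1}"]) (use inner in \<open>auto simp: emeasure_lborel_countable\<close>)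
    also have "\<dots> = ennreal (192 * R * lam powr (-3/2) * c1) * (\<integral>\<^sup>+q. ennreal (?g q) \<partial>lborel)"
    proof -
      have "ennreal (192 * R * lam powr (-3/2) * c1 * ?g q) = ennreal (192 * R * lam powr (-3/2) * c1) * ennreal (?g q)" for q
        using R c1 by (intro ennreal_mult) auto
      then show ?thesis by (simp only:) (rule nn_integral_cmult, measurable)
    qed
    also have "(\<integral>\<^sup>+q. ennreal (?g q) \<partial>lborel) = (\<integral>\<^sup>+q. ennreal (?J q * \<bar>q\<bar> powr (-3/4)) \<partial>lborel)
        + (\<integral>\<^sup>+q. ennreal (?J (2 * t1 - q) * \<bar>2 * t1 - q\<bar> powr (-3/4)) \<partial>lborel)"
      by (subst nn_integral_add[symmetric]) (auto intro!: nn_integral_cong)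
    also have "(\<integral>\<^sup>+q. ennreal (?J (2 * t1 - q) * \<bar>2 * t1 - q\<bar> powr (-3/4)) \<partial>lborel)
        = (\<integral>\<^sup>+q. ennreal (?J q * \<bar>q\<bar> powr (-3/4)) \<partial>lborel)"
      using nn_integral_real_affine[of "\<lambda>q. ennreal (?J q * \<bar>q\<bar> powr (-3/4))" "-1" "2 * t1"] by simp
    also have "ennreal (192 * R * lam powr (-3/2) * c1) *
       ((\<integral>\<^sup>+q. ennreal (?J q * \<bar>q\<bar> powr (-3/4)) \<partial>lborel) + (\<integral>\<^sup>+q. ennreal (?J q * \<bar>q\<bar> powr (-3/4)) \<partial>lborel))
       = ennreal (B * lam powr (-3/2))"
      unfolding c2 B_def using R c1 c2 by (simp add: mult_ac flip: ennreal_mult' ennreal_plus)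
    finally show "(\<integral>\<^sup>+s1. (\<integral>\<^sup>+s2. (\<integral>\<^sup>+t2. ?\<Phi> s1 s2 t2 \<partial>lborel) \<partial>lborel) \<partial>lborel)
      \<le> ennreal (B * lam powr (-3/2))" .
  qed
qed

section \<open>Oscillatory integrals\<close>

text \<open>Integration by parts: \<open>?F\<close> is the oscillating factor divided by the
  derivative of the phase, and \<open>?F' = ?e - ?r\<close>. The boundary terms and the integral of
  \<open>|?r|\<close> add up to exactly 1 / (mu delta), because the contributions at R cancel; hence
  the uniformity in R.\<close>

lemma oscillatory_tail_bound:
  fixes \<mu> \<delta> R :: real
  assumes \<mu>: "0 < \<mu>" and \<delta>: "0 < \<delta>" "\<delta> \<le> R"
  shows "norm (integral {\<delta>..R} (\<lambda>v. exp (\<i> * complex_of_real (\<mu> * v\<^sup>2)))) \<le> 1 / (\<mu> * \<delta>)"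
proof -
  let ?e = "\<lambda>v. exp (\<i> * complex_of_real (\<mu> * v\<^sup>2))"
  let ?F = "\<lambda>v. ?e v / (2 * \<i> * of_real (\<mu> * v))"
  let ?r = "\<lambda>v. ?e v / (2 * \<i> * of_real (\<mu> * v\<^sup>2))"
  have "((\<lambda>v. ?e v - ?r v) has_integral ?F R - ?F \<delta>) {\<delta>..R}"
  proof (rule fundamental_theorem_of_calculus[OF \<delta>(2)])
    fix v assume "v \<in> {\<delta>..R}"
    then have v: "v \<noteq> 0" using \<delta> by auto
    show "(?F has_vector_derivative ?e v - ?r v) (at v within {\<delta>..R})"
    proof -
      have "((\<lambda>z. exp (\<i> * of_real \<mu> * z\<^sup>2) / (2 * \<i> * of_real \<mu> * z)) has_field_derivative ?e v - ?r v) (at (of_real v))"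
        using v \<mu> by (auto intro!: derivative_eq_intros simp: field_simps power2_eq_square)
      from has_vector_derivative_real_field[OF this]
      show ?thesis by (simp add: mult.assoc)
    qed
  qed
  moreover have r: "?r integrable_on {\<delta>..R}"
    using \<delta> \<mu> by (intro integrable_continuous_real continuous_intros) auto
  ultimately have "((\<lambda>v. (?e v - ?r v) + ?r v) has_integral (?F R - ?F \<delta>) + integral {\<delta>..R} ?r) {\<delta>..R}"
    by (intro has_integral_add integrable_integral)
  then have eq: "integral {\<delta>..R} ?e = (?F R - ?F \<delta>) + integral {\<delta>..R} ?r"
    by (simp add: integral_unique)
  have nF: "norm (?F R) = 1 / (2 * \<mu> * R)" "norm (?F \<delta>) = 1 / (2 * \<mu> * \<delta>)"
    using \<mu> \<delta> by (simp_all add: norm_divide norm_mult abs_mult)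
  have tail: "norm (integral {\<delta>..R} ?r) \<le> 1 / (2 * \<mu> * \<delta>) - 1 / (2 * \<mu> * R)"
  proof -
    have I: "((\<lambda>v. 1 / (2 * \<mu> * v\<^sup>2)) has_integral (- 1 / (2 * \<mu> * R)) - (- 1 / (2 * \<mu> * \<delta>))) {\<delta>..R}"
    proof (rule fundamental_theorem_of_calculus[OF \<delta>(2)])
      fix v assume "v \<in> {\<delta>..R}"
      then have v: "v \<noteq> 0" using \<delta> by auto
      show "((\<lambda>v. - 1 / (2 * \<mu> * v)) has_vector_derivative 1 / (2 * \<mu> * v\<^sup>2)) (at v within {\<delta>..R})"
        unfolding has_real_derivative_iff_has_vector_derivative[symmetric]
        using v \<mu> by (auto intro!: derivative_eq_intros simp: field_simps power2_eq_square)
    qed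
    have "norm (integral {\<delta>..R} ?r) \<le> integral {\<delta>..R} (\<lambda>v. 1 / (2 * \<mu> * v\<^sup>2))"
      using \<mu> I by (intro integral_norm_bound_integral r) (auto simp: norm_divide norm_mult norm_power abs_mult)
    also have "\<dots> = 1 / (2 * \<mu> * \<delta>) - 1 / (2 * \<mu> * R)"
      using I by (simp add: integral_unique)
    finally show ?thesis .
  qed
  have "norm (integral {\<delta>..R} ?e) \<le> (norm (?F R) + norm (?F \<delta>)) + norm (integral {\<delta>..R} ?r)"
    unfolding eq by (meson add_mono norm_triangle_ineq norm_triangle_ineq4 order_trans order_refl)
  also have "\<dots> \<le> (1 / (2 * \<mu> * R) + 1 / (2 * \<mu> * \<delta>)) + (1 / (2 * \<mu> * \<delta>) - 1 / (2 * \<mu> * R))"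
    unfolding nF by (intro add_left_mono tail)
  also have "\<dots> = 1 / (\<mu> * \<delta>)" by (simp add: field_simps)
  finally show ?thesis .
qed

text \<open>The second-derivative estimate of van der Corput in its simplest case. The cut delta =
  mu^(-1/2) balances the trivial bound delta near 0 against the tail bound 1 / (mu delta); each side
  costs 2 delta, and the integrand is even.\<close>

lemma fresnel_bound_pos:
  fixes \<mu> R :: real
  assumes \<mu>: "0 < \<mu>" and R: "0 \<le> R"
  shows "norm (integral {-R..R} (\<lambda>v. exp (\<i> * complex_of_real (\<mu> * v\<^sup>2)))) \<le> 4 / sqrt \<mu>"
proof -
  let ?e = "\<lambda>v. exp (\<i> * complex_of_real (\<mu> * v\<^sup>2))"
  have int: "?e integrable_on {a..b}" for a b
    by (intro integrable_continuous_real continuous_intros)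
  have triv: "norm (integral {0..b} ?e) \<le> b" if "0 \<le> b" for b
    using integral_norm_bound_integral[of ?e "{0..b}" "\<lambda>_. 1"] int that by (simp add: integrable_const_ivl)
  define \<delta> where "\<delta> = 1 / sqrt \<mu>"
  have \<delta>: "0 < \<delta>" "1 / (\<mu> * \<delta>) = \<delta>"
    using \<mu> by (auto simp: \<delta>_def field_simps)
  have half: "norm (integral {0..R} ?e) \<le> 2 * \<delta>"
  proof (cases "R \<le> \<delta>")
    case True
    then show ?thesis using triv[OF R] \<delta>(1) by linarith
  next
    case False
    have "integral {0..R} ?e = integral {0..\<delta>} ?e + integral {\<delta>..R} ?e"
      using False \<delta> by (intro Henstock_Kurzweil_Integration.integral_combine[symmetric] int) auto
    moreover have "norm (integral {\<delta>..R} ?e) \<le> \<delta>"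
      using oscillatory_tail_bound[of \<mu> \<delta> R] \<mu> \<delta> False by simp
    ultimately show ?thesis
      using norm_triangle_mono[OF triv[of \<delta>], of "integral {\<delta>..R} ?e" \<delta>] \<delta>(1) by (simp only: mult_2 less_imp_le)
  qed
  have "integral {-R..R} ?e = integral {-R..0} ?e + integral {0..R} ?e"
    using R by (intro Henstock_Kurzweil_Integration.integral_combine[symmetric] int) auto
  also have "integral {-R..0} ?e = integral {0..R} ?e"
    using Henstock_Kurzweil_Integration.integral_reflect_real[where f = "?e" and a = 0 and b = R] by simp
  finally have "norm (integral {-R..R} ?e) \<le> 2 * \<delta> + 2 * \<delta>"
    using norm_triangle_mono[OF half half] by (simp only:)
  then show ?thesis by (simp add: \<delta>_def)
qed

text \<open>The density encodes Lebesgue measure restricted to [-R, R], the finite measure that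
  carries the variable v in \<open>osc_L4_bound\<close>. Negative q reduces to positive q by complex
  conjugation.\<close>

lemma fresnel_bound:
  fixes lam q R :: real
  assumes lam: "0 < lam" and R: "0 \<le> R"
  shows "norm (\<integral>v. exp (\<i> * complex_of_real (lam * (v\<^sup>2 * q))) \<partial>density lborel (\<lambda>v. ennreal (indicator {-R..R} v)))
     \<le> (if q = 0 then 2 * R else 4 / sqrt (lam * \<bar>q\<bar>))"
proof -
  let ?f = "\<lambda>q v. exp (\<i> * complex_of_real (lam * (v\<^sup>2 * q)))"
  have "(\<integral>v. ?f q v \<partial>density lborel (\<lambda>v. ennreal (indicator {-R..R} v))) = (\<integral>v. indicator {-R..R} v *\<^sub>R ?f q v \<partial>lborel)"
    by (rule integral_density) auto
  also have "\<dots> = integral {-R..R} (?f q)"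
  proof -
    have "set_integrable lborel {-R..R} (?f q)"
      by (intro borel_integrable_atLeastAtMost' continuous_intros)
    then show ?thesis
      using set_borel_integral_eq_integral(2)[of "{-R..R}" "?f q"]
      by (simp only: set_lebesgue_integral_def)
  qed
  also have "norm \<dots> \<le> (if q = 0 then 2 * R else 4 / sqrt (lam * \<bar>q\<bar>))"
  proof -
    consider "q = 0" | "0 < q" | "q < 0" by linarith
    then show ?thesis
    proof cases
      case 1
      then show ?thesis using R by simp
    next
      case 2
      then show ?thesis using fresnel_bound_pos[of "lam * q" R] lam R by (simp add: mult_ac)
    next
      case 3
      have "integral {-R..R} (?f q) = cnj (integral {-R..R} (?f (- q)))"
        by (subst Henstock_Kurzweil_Integration.integral_cnj) (simp add: exp_cnj)
      then show ?thesis using fresnel_bound_pos[of "lam * (- q)" R] mult_pos_neg[OF lam 3] R 3 by (simp add: mult_ac)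
    qed
  qed
  finally show ?thesis .
qed

section \<open>Squares of oscillatory integrals as double integrals\<close>

lemma integrable_product:
  fixes f :: "'a \<Rightarrow> 'c::{banach, second_countable_topology, real_normed_field}"
  assumes "sigma_finite_measure M" "sigma_finite_measure N"
    and f: "integrable M f" and g: "integrable N g"
  shows "integrable (M \<Otimes>\<^sub>M N) (\<lambda>z. f (fst z) * g (snd z))"
    and "(\<integral>z. f (fst z) * g (snd z) \<partial>(M \<Otimes>\<^sub>M N)) = (\<integral>x. f x \<partial>M) * (\<integral>y. g y \<partial>N)"
proof -
  interpret pair_sigma_finite M N using assms(1,2) by (rule pair_sigma_finite.intro)
  note [measurable] = borel_measurable_integrable[OF f] borel_measurable_integrable[OF g]
  have "integrable M (\<lambda>x. \<integral>y. norm (f x * g y) \<partial>N)"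
    using f by (simp add: norm_mult)
  moreover have "AE x in M. integrable N (\<lambda>y. f x * g y)"
    using g by auto
  ultimately have I: "integrable (M \<Otimes>\<^sub>M N) (\<lambda>(x, y). f x * g y)"
    by (intro Fubini_integrable) auto
  then show "integrable (M \<Otimes>\<^sub>M N) (\<lambda>z. f (fst z) * g (snd z))"
    by (simp add: case_prod_unfold)
  have "(\<integral>x. f x \<partial>M) * (\<integral>y. g y \<partial>N) = (\<integral>x. (\<integral>y. f x * g y \<partial>N) \<partial>M)"
    using f g by simp
  also have "\<dots> = (\<integral>z. f (fst z) * g (snd z) \<partial>(M \<Otimes>\<^sub>M N))"
    using integral_fst[OF I] by (simp add: case_prod_unfold)
  finally show "(\<integral>z. f (fst z) * g (snd z) \<partial>(M \<Otimes>\<^sub>M N)) = (\<integral>x. f x \<partial>M) * (\<integral>y. g y \<partial>N)" ..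
qed

lemma measurable_cnj [measurable]: "cnj \<in> borel_measurable borel"
  by (intro borel_measurable_continuous_onI continuous_intros)

text \<open>The expansion behind the TT* method: |H|^2 = H cnj(H) becomes an integral over (z, z'),
  and the integral over omega is carried out before absolute values are taken, so that its
  cancellation survives. Finiteness of M and the bound on \<open>e\<close> make the full integrand
  \<open>\<Phi>\<close> absolutely integrable, as Fubini requires.\<close>

lemma nn_integral_square_oscillatory_le:
  fixes e :: "'a \<times> 'b \<Rightarrow> complex"
  assumes "finite_measure M" "sigma_finite_measure N"
    and e [measurable]: "e \<in> borel_measurable (M \<Otimes>\<^sub>M N)" and e_le: "\<And>x. cmod (e x) \<le> 1"
    and G: "integrable N G"
  shows "(\<integral>\<^sup>+\<omega>. ennreal ((cmod (\<integral>z. e (\<omega>, z) * G z \<partial>N))\<^sup>2) \<partial>M)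
    \<le> (\<integral>\<^sup>+z. (\<integral>\<^sup>+z'. ennreal (cmod (G z) * cmod (G z') * cmod (\<integral>\<omega>. e (\<omega>, z) * cnj (e (\<omega>, z')) \<partial>M)) \<partial>N) \<partial>N)"
proof -
  interpret M: finite_measure M by fact
  interpret N: sigma_finite_measure N by fact
  interpret NN: pair_sigma_finite N N ..
  interpret MNN: pair_sigma_finite M "N \<Otimes>\<^sub>M N" ..
  note [measurable] = borel_measurable_integrable[OF G]
  define \<Phi> where "\<Phi> = (\<lambda>(\<omega>, z, z'). (e (\<omega>, z) * G z) * cnj (e (\<omega>, z') * G z'))"
  have [measurable]: "\<Phi> \<in> borel_measurable (M \<Otimes>\<^sub>M (N \<Otimes>\<^sub>M N))"
    unfolding \<Phi>_def by measurable
  have "integrable (M \<Otimes>\<^sub>M (N \<Otimes>\<^sub>M N)) (\<lambda>x. 1 * (cmod (G (fst (snd x))) * cmod (G (snd (snd x)))))"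
    using integrable_product(1)[of M "N \<Otimes>\<^sub>M N" "\<lambda>_. 1::real" "\<lambda>y. cmod (G (fst y)) * cmod (G (snd y))"]
      integrable_product(1)[of N N "\<lambda>z. cmod (G z)" "\<lambda>z. cmod (G z)"] G
      M.sigma_finite_measure_axioms N.sigma_finite_measure_axioms NN.sigma_finite_measure_axioms by simp
  then have \<Phi>: "integrable (M \<Otimes>\<^sub>M (N \<Otimes>\<^sub>M N)) \<Phi>"
  proof (rule Bochner_Integration.integrable_bound, safe intro!: AE_I2)
    fix \<omega> z z'
    have "norm (\<Phi> (\<omega>, z, z')) = (cmod (e (\<omega>, z)) * cmod (e (\<omega>, z'))) * (cmod (G z) * cmod (G z'))"
      by (simp add: \<Phi>_def norm_mult)
    also have "\<dots> \<le> 1 * (cmod (G z) * cmod (G z'))"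
      by (intro mult_right_mono mult_le_one e_le) auto
    finally show "norm (\<Phi> (\<omega>, z, z')) \<le> norm (1 * (cmod (G (fst (snd (\<omega>, z, z')))) * cmod (G (snd (snd (\<omega>, z, z'))))))"
      by simp
  qed simp
  let ?H = "\<lambda>\<omega>. \<integral>z. e (\<omega>, z) * G z \<partial>N"
  have H: "complex_of_real ((cmod (?H \<omega>))\<^sup>2) = (\<integral>y. \<Phi> (\<omega>, y) \<partial>(N \<Otimes>\<^sub>M N))" if "\<omega> \<in> space M" for \<omega>
  proof -
    have int: "integrable N (\<lambda>z. e (\<omega>, z) * G z)"
      using that e_le
      by (intro Bochner_Integration.integrable_bound[OF G] AE_I2) (auto simp: norm_mult mult_left_le_one_le)
    have "complex_of_real ((cmod (?H \<omega>))\<^sup>2) = ?H \<omega> * cnj (?H \<omega>)"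
      by (rule complex_norm_square)
    also have "cnj (?H \<omega>) = (\<integral>z. cnj (e (\<omega>, z) * G z) \<partial>N)"
      by (rule Bochner_Integration.integral_cnj[symmetric])
    also have "?H \<omega> * \<dots> = (\<integral>y. (e (\<omega>, fst y) * G (fst y)) * cnj (e (\<omega>, snd y) * G (snd y)) \<partial>(N \<Otimes>\<^sub>M N))"
      using int N.sigma_finite_measure_axioms
      by (intro integrable_product(2)[symmetric]) (auto simp del: complex_cnj_mult)
    finally show ?thesis by (simp add: \<Phi>_def case_prod_unfold)
  qed
  have int2: "integrable M (\<lambda>\<omega>. (cmod (?H \<omega>))\<^sup>2)"
  proof -
    have "integrable M (\<lambda>\<omega>. Re (\<integral>y. \<Phi> (\<omega>, y) \<partial>(N \<Otimes>\<^sub>M N)))"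
      by (intro integrable_Re MNN.integrable_fst' \<Phi>)
    moreover have "Re (\<integral>y. \<Phi> (\<omega>, y) \<partial>(N \<Otimes>\<^sub>M N)) = (cmod (?H \<omega>))\<^sup>2" if "\<omega> \<in> space M" for \<omega>
      using H[OF that] by (metis Re_complex_of_real)
    ultimately show ?thesis by (simp cong: Bochner_Integration.integrable_cong)
  qed
  \<comment> \<open>The nonnegative integral is turned into a complex Bochner integral, since after
    the exchange of order the integrand is no longer nonnegative.\<close>
  have "(\<integral>\<^sup>+\<omega>. ennreal ((cmod (?H \<omega>))\<^sup>2) \<partial>M) = ennreal (\<integral>\<omega>. (cmod (?H \<omega>))\<^sup>2 \<partial>M)"
    by (intro nn_integral_eq_integral int2) auto
  also have "(\<integral>\<omega>. (cmod (?H \<omega>))\<^sup>2 \<partial>M) = cmod (\<integral>\<omega>. complex_of_real ((cmod (?H \<omega>))\<^sup>2) \<partial>M)"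
    by (subst integral_complex_of_real) (simp add: integral_nonneg_AE)
  also have "(\<integral>\<omega>. complex_of_real ((cmod (?H \<omega>))\<^sup>2) \<partial>M) = (\<integral>\<omega>. (\<integral>y. \<Phi> (\<omega>, y) \<partial>(N \<Otimes>\<^sub>M N)) \<partial>M)"
    by (intro Bochner_Integration.integral_cong H) auto
  also have "\<dots> = (\<integral>y. (\<integral>\<omega>. \<Phi> (\<omega>, y) \<partial>M) \<partial>(N \<Otimes>\<^sub>M N))"
    using MNN.Fubini_integral[of "\<lambda>\<omega> y. \<Phi> (\<omega>, y)"] \<Phi> by simp
  also have "ennreal (cmod \<dots>) \<le> (\<integral>\<^sup>+y. ennreal (cmod (\<integral>\<omega>. \<Phi> (\<omega>, y) \<partial>M)) \<partial>(N \<Otimes>\<^sub>M N))"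
    using MNN.integrable_snd[of "\<lambda>\<omega> y. \<Phi> (\<omega>, y)"] \<Phi> by (intro integral_norm_bound_ennreal) simp
  also have "\<dots> = (\<integral>\<^sup>+z. (\<integral>\<^sup>+z'. ennreal (cmod (\<integral>\<omega>. \<Phi> (\<omega>, z, z') \<partial>M)) \<partial>N) \<partial>N)"
    by (intro N.nn_integral_fst[symmetric]) measurable
  also have "\<dots> = (\<integral>\<^sup>+z. (\<integral>\<^sup>+z'. ennreal (cmod (G z) * cmod (G z') * cmod (\<integral>\<omega>. e (\<omega>, z) * cnj (e (\<omega>, z')) \<partial>M)) \<partial>N) \<partial>N)"
  proof (rule nn_integral_cong, rule nn_integral_cong)
    fix z z'
    have "(\<integral>\<omega>. \<Phi> (\<omega>, z, z') \<partial>M) = (\<integral>\<omega>. (G z * cnj (G z')) * (e (\<omega>, z) * cnj (e (\<omega>, z'))) \<partial>M)"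
      by (intro Bochner_Integration.integral_cong) (auto simp: \<Phi>_def)
    also have "\<dots> = (G z * cnj (G z')) * (\<integral>\<omega>. e (\<omega>, z) * cnj (e (\<omega>, z')) \<partial>M)"
      by simp
    finally show "ennreal (cmod (\<integral>\<omega>. \<Phi> (\<omega>, z, z') \<partial>M)) = ennreal (cmod (G z) * cmod (G z') * cmod (\<integral>\<omega>. e (\<omega>, z) * cnj (e (\<omega>, z')) \<partial>M))"
      by (simp add: norm_mult)
  qed
  finally show ?thesis .
qed

section \<open>The Schur-type bound for the positive kernel\<close>

lemma hkernel_uminus: "hkernel R lam (- p) (- q) = hkernel R lam p q"
  by (simp add: hkernel_def)

definition box_kernel :: "real \<Rightarrow> real \<Rightarrow> real \<times> real \<Rightarrow> real \<times> real \<Rightarrow> real" where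
  "box_kernel R lam z z' = indicator {-R..R} (fst z) * indicator {-R..R} (snd z)
      * indicator {-R..R} (fst z') * indicator {-R..R} (snd z')
      * hkernel R lam ((fst z)\<^sup>2 + (snd z)\<^sup>2 - ((fst z')\<^sup>2 + (snd z')\<^sup>2)) (fst z + snd z - (fst z' + snd z'))"

lemma box_kernel_measurable [measurable]:
  assumes [measurable]: "f \<in> M \<rightarrow>\<^sub>M borel \<Otimes>\<^sub>M borel" "g \<in> M \<rightarrow>\<^sub>M borel \<Otimes>\<^sub>M borel"
  shows "(\<lambda>x. box_kernel R lam (f x) (g x)) \<in> borel_measurable M"
  unfolding box_kernel_def by measurable

text \<open>The four fourth powers from the arithmetic-geometric mean inequality give equal
  integrals: the kernel is invariant under swapping the entries of z, and under exchanging z and z',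
  which flips the signs of both p and q. So only the term with t1 fixed has to be estimated, and
  there the other three variables are free as in
  \<open>triple_integral_kernel_bound\<close>.\<close>

lemma kernel_schur_bound:
  fixes R :: real
  assumes R: "1 \<le> R"
  obtains B where "0 \<le> B" "\<And>lam \<gamma>. 0 < lam \<Longrightarrow> \<gamma> \<in> borel_measurable borel \<Longrightarrow> (\<And>t. 0 \<le> \<gamma> t) \<Longrightarrow>
     (\<And>t. R < \<bar>t\<bar> \<Longrightarrow> \<gamma> t = 0) \<Longrightarrow>
     (\<integral>\<^sup>+z. (\<integral>\<^sup>+z'. ennreal (\<gamma> (fst z) * \<gamma> (snd z) * (\<gamma> (fst z') * \<gamma> (snd z')) *
        hkernel R lam ((fst z)\<^sup>2 + (snd z)\<^sup>2 - ((fst z')\<^sup>2 + (snd z')\<^sup>2)) (fst z + snd z - (fst z' + snd z')))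
         \<partial>(lborel \<Otimes>\<^sub>M lborel)) \<partial>(lborel \<Otimes>\<^sub>M lborel))
     \<le> ennreal (B * lam powr (-3/2)) * (\<integral>\<^sup>+t. ennreal (\<gamma> t ^ 4) \<partial>lborel)"
proof -
  obtain B where B: "0 \<le> B" "\<And>lam t1. 0 < lam \<Longrightarrow> \<bar>t1\<bar> \<le> R \<Longrightarrow>
     (\<integral>\<^sup>+s1. (\<integral>\<^sup>+s2. (\<integral>\<^sup>+t2. ennreal (indicator {-R..R} s1 * indicator {-R..R} s2 * indicator {-R..R} t2 *
        hkernel R lam (t1\<^sup>2 + t2\<^sup>2 - (s1\<^sup>2 + s2\<^sup>2)) (t1 + t2 - (s1 + s2))) \<partial>lborel) \<partial>lborel) \<partial>lborel)
     \<le> ennreal (B * lam powr (-3/2))"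
    by (rule triple_integral_kernel_bound[OF R]) blast
  show thesis
  proof (rule that[OF B(1)])
    fix lam :: real and \<gamma> :: "real \<Rightarrow> real"
    assume lam: "0 < lam" and [measurable]: "\<gamma> \<in> borel_measurable borel" and \<gamma>: "\<And>t. 0 \<le> \<gamma> t"
      and supp: "\<And>t. R < \<bar>t\<bar> \<Longrightarrow> \<gamma> t = 0"
    let ?L2 = "lborel \<Otimes>\<^sub>M lborel :: (real \<times> real) measure"
    interpret L2: pair_sigma_finite ?L2 ?L2 
      by (simp add: lborel_prod pair_sigma_finite_def sigma_finite_lborel)
    have sf: "sigma_finite_measure ?L2"
      by (simp add: lborel_prod sigma_finite_lborel)
    define I where "I = (\<lambda>s. indicator {-R..R} s :: real)"
    have I [measurable]: "I \<in> borel_measurable borel" "\<And>s. 0 \<le> I s" by (auto simp: I_def)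
    define k where k_eq: "k = box_kernel R lam"
    have k_def: "k z z' = I (fst z) * I (snd z) * I (fst z') * I (snd z') *
        hkernel R lam ((fst z)\<^sup>2 + (snd z)\<^sup>2 - ((fst z')\<^sup>2 + (snd z')\<^sup>2)) (fst z + snd z - (fst z' + snd z'))" for z z'
      by (simp add: k_eq box_kernel_def I_def)
    have k_meas [measurable]: "(\<lambda>x. k (f x) (g x)) \<in> borel_measurable M"
      if [measurable]: "f \<in> M \<rightarrow>\<^sub>M borel \<Otimes>\<^sub>M borel" "g \<in> M \<rightarrow>\<^sub>M borel \<Otimes>\<^sub>M borel" for f g and M :: "'c measure"
      unfolding k_eq by measurable
    have k_nn: "0 \<le> k z z'" for z z'
      using R lam by (auto simp: k_def I intro!: mult_nonneg_nonneg hkernel_nonneg)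
    have k_sym: "k z' z = k z z'" for z z'
      using hkernel_uminus[of R lam "(fst z)\<^sup>2 + (snd z)\<^sup>2 - ((fst z')\<^sup>2 + (snd z')\<^sup>2)" "fst z + snd z - (fst z' + snd z')"]
      by (simp add: k_def mult_ac)
    have k_swap: "k (t2, t1) z' = k (t1, t2) z'" for t1 t2 z'
      by (simp add: k_def add.commute mult_ac)
    let ?T = "\<lambda>f. (\<integral>\<^sup>+z. (\<integral>\<^sup>+z'. ennreal (f z z' * k z z') \<partial>?L2) \<partial>?L2)"
    let ?A = "ennreal (B * lam powr (-3/2)) * (\<integral>\<^sup>+t. ennreal (\<gamma> t ^ 4) \<partial>lborel)"
    have T1: "?T (\<lambda>z z'. \<gamma> (fst z) ^ 4) \<le> ?A"
    proof -
      have "?T (\<lambda>z z'. \<gamma> (fst z) ^ 4) = (\<integral>\<^sup>+t1. (\<integral>\<^sup>+t2. (\<integral>\<^sup>+z'. ennreal (\<gamma> t1 ^ 4 * k (t1, t2) z') \<partial>?L2) \<partial>lborel) \<partial>lborel)"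
        by (subst lborel.nn_integral_fst[symmetric]) auto
      also have "\<dots> = (\<integral>\<^sup>+t1. ennreal (\<gamma> t1 ^ 4) * (\<integral>\<^sup>+t2. (\<integral>\<^sup>+z'. ennreal (k (t1, t2) z') \<partial>?L2) \<partial>lborel) \<partial>lborel)"
      proof (rule nn_integral_cong)
        fix t1
        have "(\<integral>\<^sup>+t2. (\<integral>\<^sup>+z'. ennreal (\<gamma> t1 ^ 4 * k (t1, t2) z') \<partial>?L2) \<partial>lborel)
          = (\<integral>\<^sup>+t2. ennreal (\<gamma> t1 ^ 4) * (\<integral>\<^sup>+z'. ennreal (k (t1, t2) z') \<partial>?L2) \<partial>lborel)"
          using \<gamma> k_nn by (intro nn_integral_cong, subst nn_integral_cmult[symmetric])
            (auto simp: ennreal_mult)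
        also have "\<dots> = ennreal (\<gamma> t1 ^ 4) * (\<integral>\<^sup>+t2. (\<integral>\<^sup>+z'. ennreal (k (t1, t2) z') \<partial>?L2) \<partial>lborel)"
          by (rule nn_integral_cmult) measurable
        finally show "(\<integral>\<^sup>+t2. (\<integral>\<^sup>+z'. ennreal (\<gamma> t1 ^ 4 * k (t1, t2) z') \<partial>?L2) \<partial>lborel) = \<dots>" .
      qed
      also have "\<dots> \<le> (\<integral>\<^sup>+t1. ennreal (\<gamma> t1 ^ 4) * ennreal (B * lam powr (-3/2)) \<partial>lborel)"
      proof (rule nn_integral_mono)
        fix t1
        show "ennreal (\<gamma> t1 ^ 4) * (\<integral>\<^sup>+t2. (\<integral>\<^sup>+z'. ennreal (k (t1, t2) z') \<partial>?L2) \<partial>lborel)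
          \<le> ennreal (\<gamma> t1 ^ 4) * ennreal (B * lam powr (-3/2))"
        proof (cases "\<bar>t1\<bar> \<le> R")
          case True
          then have 1: "I t1 = 1" by (auto simp: I_def indicator_def abs_le_iff)
          have "(\<integral>\<^sup>+t2. (\<integral>\<^sup>+z'. ennreal (k (t1, t2) z') \<partial>?L2) \<partial>lborel)
            = (\<integral>\<^sup>+t2. (\<integral>\<^sup>+s1. (\<integral>\<^sup>+s2. ennreal (k (t1, t2) (s1, s2)) \<partial>lborel) \<partial>lborel) \<partial>lborel)"
            by (rule nn_integral_cong, rule lborel.nn_integral_fst[symmetric]) measurable
          also have "\<dots> = (\<integral>\<^sup>+s1. (\<integral>\<^sup>+t2. (\<integral>\<^sup>+s2. ennreal (k (t1, t2) (s1, s2)) \<partial>lborel) \<partial>lborel) \<partial>lborel)"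
            by (rule lborel_pair.Fubini', measurable)
          also have "\<dots> = (\<integral>\<^sup>+s1. (\<integral>\<^sup>+s2. (\<integral>\<^sup>+t2. ennreal (k (t1, t2) (s1, s2)) \<partial>lborel) \<partial>lborel) \<partial>lborel)"
            by (rule nn_integral_cong, rule lborel_pair.Fubini', measurable)
          also have "\<dots> \<le> ennreal (B * lam powr (-3/2))"
            using B(2)[OF lam True] by (simp add: k_def 1 mult_ac) (simp add: I_def)
          finally show ?thesis by (intro mult_left_mono) auto
        qed (simp add: supp)
      qed
      also have "\<dots> = ?A" by (subst nn_integral_multc) (auto simp: mult.commute)
      finally show ?thesis .
    qed
    have T2: "?T (\<lambda>z z'. \<gamma> (snd z) ^ 4) = ?T (\<lambda>z z'. \<gamma> (fst z) ^ 4)"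
    proof -
      have "?T (\<lambda>z z'. \<gamma> (snd z) ^ 4) = (\<integral>\<^sup>+t2. (\<integral>\<^sup>+t1. (\<integral>\<^sup>+z'. ennreal (\<gamma> t2 ^ 4 * k (t1, t2) z') \<partial>?L2) \<partial>lborel) \<partial>lborel)"
        by (subst lborel_pair.nn_integral_snd[symmetric]) auto
      also have "\<dots> = ?T (\<lambda>z z'. \<gamma> (fst z) ^ 4)"
        by (subst lborel.nn_integral_fst[symmetric]) (auto simp: k_swap)
      finally show ?thesis .
    qed
    have T3: "?T (\<lambda>z z'. \<gamma> (fst z') ^ 4) = ?T (\<lambda>z z'. \<gamma> (fst z) ^ 4)"
      by (subst L2.Fubini') (auto simp: k_sym)
    have T4: "?T (\<lambda>z z'. \<gamma> (snd z') ^ 4) = ?T (\<lambda>z z'. \<gamma> (snd z) ^ 4)"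
      by (subst L2.Fubini') (auto simp: k_sym)
    have amgm: "a * b * (c * d) \<le> (a ^ 4 + b ^ 4 + c ^ 4 + d ^ 4) / 4" for a b c d :: real
    proof -
      have *: "x \<le> (p + q + r + s) / 4" if "x \<le> (y + z) / 2" "y \<le> (p + q) / 2" "z \<le> (r + s) / 2" for x y z p q r s :: real
        using that by (simp add: field_simps)
      have "a * b * (c * d) \<le> ((a * b)\<^sup>2 + (c * d)\<^sup>2) / 2"
        using sum_squares_bound[of "a * b" "c * d"] by simp
      moreover have "(a * b)\<^sup>2 \<le> (a ^ 4 + b ^ 4) / 2" "(c * d)\<^sup>2 \<le> (c ^ 4 + d ^ 4) / 2"
        using sum_squares_bound[of "a\<^sup>2" "b\<^sup>2"] sum_squares_bound[of "c\<^sup>2" "d\<^sup>2"]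
        by (simp_all add: power_mult_distrib flip: power_mult)
      ultimately show ?thesis by (rule *)
    qed
    have pt: "ennreal (\<gamma> (fst z) * \<gamma> (snd z) * (\<gamma> (fst z') * \<gamma> (snd z')) *
        hkernel R lam ((fst z)\<^sup>2 + (snd z)\<^sup>2 - ((fst z')\<^sup>2 + (snd z')\<^sup>2)) (fst z + snd z - (fst z' + snd z')))
      \<le> ennreal (1/4) * ((ennreal (\<gamma> (fst z) ^ 4 * k z z') + ennreal (\<gamma> (snd z) ^ 4 * k z z'))
         + (ennreal (\<gamma> (fst z') ^ 4 * k z z') + ennreal (\<gamma> (snd z') ^ 4 * k z z')))" (is "ennreal (?g * ?h) \<le> _") for z z'
    proof -
      \<comment> \<open>The box cutoff is inserted before the mean inequality: afterwards each term
        contains only one of the four values of \<open>\<gamma>\<close>, which no longer confines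
        the other variables.\<close>
      have \<gamma>I: "\<gamma> s * I s = \<gamma> s" for s using supp[of s] by (cases "\<bar>s\<bar> \<le> R") (auto simp: I_def indicator_def abs_le_iff)
      have "?g * ?h = (\<gamma> (fst z) * I (fst z)) * (\<gamma> (snd z) * I (snd z)) * ((\<gamma> (fst z') * I (fst z')) * (\<gamma> (snd z') * I (snd z'))) * ?h"
        unfolding \<gamma>I by simp
      also have "\<dots> = ?g * k z z'" by (simp add: k_def mult_ac)
      also have "\<dots> \<le> ((\<gamma> (fst z) ^ 4 + \<gamma> (snd z) ^ 4 + \<gamma> (fst z') ^ 4 + \<gamma> (snd z') ^ 4) / 4) * k z z'"
        by (intro mult_right_mono amgm k_nn)
      also have "\<dots> = 1/4 * ((\<gamma> (fst z) ^ 4 * k z z' + \<gamma> (snd z) ^ 4 * k z z') + (\<gamma> (fst z') ^ 4 * k z z' + \<gamma> (snd z') ^ 4 * k z z'))"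
        by (simp add: algebra_simps)
      finally have "ennreal (?g * ?h) \<le> ennreal \<dots>" by (rule ennreal_leI)
      also have "\<dots> = ennreal (1/4) * ((ennreal (\<gamma> (fst z) ^ 4 * k z z') + ennreal (\<gamma> (snd z) ^ 4 * k z z'))
         + (ennreal (\<gamma> (fst z') ^ 4 * k z z') + ennreal (\<gamma> (snd z') ^ 4 * k z z')))"
        using \<gamma> k_nn by (subst ennreal_mult') (simp_all del: ennreal_mult)
      finally show ?thesis .
    qed
    have "(\<integral>\<^sup>+z. (\<integral>\<^sup>+z'. ennreal (\<gamma> (fst z) * \<gamma> (snd z) * (\<gamma> (fst z') * \<gamma> (snd z')) *
        hkernel R lam ((fst z)\<^sup>2 + (snd z)\<^sup>2 - ((fst z')\<^sup>2 + (snd z')\<^sup>2)) (fst z + snd z - (fst z' + snd z'))) \<partial>?L2) \<partial>?L2)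
      \<le> (\<integral>\<^sup>+z. (\<integral>\<^sup>+z'. ennreal (1/4) * ((ennreal (\<gamma> (fst z) ^ 4 * k z z') + ennreal (\<gamma> (snd z) ^ 4 * k z z'))
         + (ennreal (\<gamma> (fst z') ^ 4 * k z z') + ennreal (\<gamma> (snd z') ^ 4 * k z z'))) \<partial>?L2) \<partial>?L2)"
      by (intro nn_integral_mono pt)
    also have "\<dots> = ennreal (1/4) * ((?T (\<lambda>z z'. \<gamma> (fst z) ^ 4) + ?T (\<lambda>z z'. \<gamma> (snd z) ^ 4))
        + (?T (\<lambda>z z'. \<gamma> (fst z') ^ 4) + ?T (\<lambda>z z'. \<gamma> (snd z') ^ 4)))"
    proof -
      \<comment> \<open>The sum is split over the product measure, where additivity asks only for
        joint measurability of the four terms.\<close>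
      have dbl: "(\<integral>\<^sup>+z. (\<integral>\<^sup>+z'. F (z, z') \<partial>?L2) \<partial>?L2) = integral\<^sup>N (?L2 \<Otimes>\<^sub>M ?L2) F"
        if "F \<in> borel_measurable (?L2 \<Otimes>\<^sub>M ?L2)" for F
        by (rule sigma_finite_measure.nn_integral_fst[OF sf that])
      define F where "F = (\<lambda>\<tau> :: (real \<times> real) \<times> (real \<times> real) \<Rightarrow> real. \<lambda>x. ennreal (\<gamma> (\<tau> x) ^ 4 * k (fst x) (snd x)))"
      have [measurable]: "F \<tau> \<in> borel_measurable (?L2 \<Otimes>\<^sub>M ?L2)" if "\<tau> \<in> borel_measurable (?L2 \<Otimes>\<^sub>M ?L2)" for \<tau>
        unfolding F_def using that by measurable
      have "(\<integral>\<^sup>+z. (\<integral>\<^sup>+z'. ennreal (1/4) * ((F (\<lambda>x. fst (fst x)) (z, z') + F (\<lambda>x. snd (fst x)) (z, z'))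
           + (F (\<lambda>x. fst (snd x)) (z, z') + F (\<lambda>x. snd (snd x)) (z, z'))) \<partial>?L2) \<partial>?L2)
        = (\<integral>\<^sup>+x. ennreal (1/4) * ((F (\<lambda>x. fst (fst x)) x + F (\<lambda>x. snd (fst x)) x)
           + (F (\<lambda>x. fst (snd x)) x + F (\<lambda>x. snd (snd x)) x)) \<partial>(?L2 \<Otimes>\<^sub>M ?L2))"
        by (rule dbl) measurable
      also have "\<dots> = ennreal (1/4) * ((integral\<^sup>N (?L2 \<Otimes>\<^sub>M ?L2) (F (\<lambda>x. fst (fst x))) + integral\<^sup>N (?L2 \<Otimes>\<^sub>M ?L2) (F (\<lambda>x. snd (fst x))))
           + (integral\<^sup>N (?L2 \<Otimes>\<^sub>M ?L2) (F (\<lambda>x. fst (snd x))) + integral\<^sup>N (?L2 \<Otimes>\<^sub>M ?L2) (F (\<lambda>x. snd (snd x)))))"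
      proof -
        have "F (\<lambda>x. fst (fst x)) \<in> borel_measurable (?L2 \<Otimes>\<^sub>M ?L2)" "F (\<lambda>x. snd (fst x)) \<in> borel_measurable (?L2 \<Otimes>\<^sub>M ?L2)"
          "F (\<lambda>x. fst (snd x)) \<in> borel_measurable (?L2 \<Otimes>\<^sub>M ?L2)" "F (\<lambda>x. snd (snd x)) \<in> borel_measurable (?L2 \<Otimes>\<^sub>M ?L2)"
          by measurable
        then show ?thesis
          by (simp only: nn_integral_cmult nn_integral_add borel_measurable_add)
      qed
      also have "\<dots> = ennreal (1/4) * ((?T (\<lambda>z z'. \<gamma> (fst z) ^ 4) + ?T (\<lambda>z z'. \<gamma> (snd z) ^ 4))
        + (?T (\<lambda>z z'. \<gamma> (fst z') ^ 4) + ?T (\<lambda>z z'. \<gamma> (snd z') ^ 4)))"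
        by (subst (1 2 3 4) dbl[symmetric]) (simp_all add: F_def)
      finally show ?thesis by (simp add: F_def)
    qed
    also have "\<dots> \<le> ennreal (1/4) * ((?A + ?A) + (?A + ?A))"
      unfolding T2 T3 T4 by (intro mult_left_mono add_mono T1) auto
    also have "\<dots> = ?A"
    proof -
      have "(?A + ?A) + (?A + ?A) = 4 * ?A" by (simp add: mult_2[symmetric] flip: mult.assoc)
      moreover have "ennreal (1/4) * (4 * x) = x" for x
        by (simp flip: mult.assoc ennreal_numeral ennreal_mult')
      ultimately show ?thesis by metis
    qed
    finally show "(\<integral>\<^sup>+z. (\<integral>\<^sup>+z'. ennreal (\<gamma> (fst z) * \<gamma> (snd z) * (\<gamma> (fst z') * \<gamma> (snd z')) *
        hkernel R lam ((fst z)\<^sup>2 + (snd z)\<^sup>2 - ((fst z')\<^sup>2 + (snd z')\<^sup>2)) (fst z + snd z - (fst z' + snd z'))) \<partial>?L2) \<partial>?L2) \<le> ?A" .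
  qed
qed

section \<open>The fourth-power estimate for amplitudes that depend on t alone\<close>

definition osc :: "real \<Rightarrow> (real \<Rightarrow> complex) \<Rightarrow> real \<times> real \<Rightarrow> complex" where
  "osc lam g w = (\<integral>t. exp (\<i> * complex_of_real (lam * (fst w * t\<^sup>2 + (snd w)\<^sup>2 * t))) * g t \<partial>lborel)"

text \<open>Squaring turns the fourth power into the square of an oscillatory integral over pairs z
  = (t1, t2), the situation of \<open>nn_integral_square_oscillatory_le\<close>. The phase sees z
  only through t1^2 + t2^2 and t1 + t2, whose differences between two pairs are p and q.\<close>

lemma osc_square:
  assumes g: "integrable lborel g"
  shows "(osc lam g w)\<^sup>2 = (\<integral>z. exp (\<i> * complex_of_real (lam * (fst w * ((fst z)\<^sup>2 + (snd z)\<^sup>2) + (snd w)\<^sup>2 * (fst z + snd z))))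
      * (g (fst z) * g (snd z)) \<partial>(lborel \<Otimes>\<^sub>M lborel))"
proof -
  let ?h = "\<lambda>t. exp (\<i> * complex_of_real (lam * (fst w * t\<^sup>2 + (snd w)\<^sup>2 * t))) * g t"
  note [measurable] = borel_measurable_integrable[OF g]
  have "integrable lborel ?h"
    by (intro Bochner_Integration.integrable_bound[OF g] AE_I2) (auto simp: norm_mult)
  then have "(osc lam g w)\<^sup>2 = (\<integral>z. ?h (fst z) * ?h (snd z) \<partial>(lborel \<Otimes>\<^sub>M lborel))"
    unfolding osc_def power2_eq_square
    by (intro integrable_product(2)[symmetric] sigma_finite_lborel)
  also have "\<dots> = (\<integral>z. exp (\<i> * complex_of_real (lam * (fst w * ((fst z)\<^sup>2 + (snd z)\<^sup>2) + (snd w)\<^sup>2 * (fst z + snd z))))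
      * (g (fst z) * g (snd z)) \<partial>(lborel \<Otimes>\<^sub>M lborel))"
    by (intro Bochner_Integration.integral_cong) (auto simp: algebra_simps exp_add)
  finally show ?thesis .
qed

text \<open>The weight in u is the standard normal law, because its characteristic function is
  exactly exp(-s^2 / 2); at s = lam p this is the Gaussian factor of \<open>hkernel\<close>. The
  weight in v is the indicator of [-R, R], which gives the Fresnel factor.\<close>

lemma osc_L4_bound:
  fixes R :: real
  assumes R: "1 \<le> R"
  obtains C where "0 \<le> C" "\<And>lam g. 0 < lam \<Longrightarrow> integrable lborel g \<Longrightarrow> (\<And>t. R < \<bar>t\<bar> \<Longrightarrow> g t = 0) \<Longrightarrow>
     (\<integral>\<^sup>+w. ennreal (indicator {-R..R} (fst w) * indicator {-R..R} (snd w) * cmod (osc lam g w) ^ 4) \<partial>(lborel \<Otimes>\<^sub>M lborel))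
     \<le> ennreal (C * lam powr (-3/2)) * (\<integral>\<^sup>+t. ennreal (cmod (g t) ^ 4) \<partial>lborel)"
proof (rule kernel_schur_bound[OF R])
  let ?L2 = "lborel \<Otimes>\<^sub>M lborel :: (real \<times> real) measure"
  fix B assume B: "0 \<le> B" "\<And>lam \<gamma>. 0 < lam \<Longrightarrow> \<gamma> \<in> borel_measurable borel \<Longrightarrow> (\<And>t. 0 \<le> \<gamma> t) \<Longrightarrow>
     (\<And>t. R < \<bar>t\<bar> \<Longrightarrow> \<gamma> t = 0) \<Longrightarrow>
     (\<integral>\<^sup>+z. (\<integral>\<^sup>+z'. ennreal (\<gamma> (fst z) * \<gamma> (snd z) * (\<gamma> (fst z') * \<gamma> (snd z')) *
        hkernel R lam ((fst z)\<^sup>2 + (snd z)\<^sup>2 - ((fst z')\<^sup>2 + (snd z')\<^sup>2)) (fst z + snd z - (fst z' + snd z')))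
         \<partial>?L2) \<partial>?L2)
     \<le> ennreal (B * lam powr (-3/2)) * (\<integral>\<^sup>+t. ennreal (\<gamma> t ^ 4) \<partial>lborel)"
  \<comment> \<open>The reciprocal of the standard normal density at R, its minimum on [-R, R]; thus
    W times the density dominates the indicator of that interval.\<close>
  define W where "W = sqrt (2 * pi) * exp (R\<^sup>2 / 2)"
  have W: "0 \<le> W" by (simp add: W_def)
  show thesis
  proof (rule that)
    show "0 \<le> W * B" using W B by simp
  next
    fix lam :: real and g :: "real \<Rightarrow> complex"
    assume lam: "0 < lam" and g: "integrable lborel g" and supp: "\<And>t. R < \<bar>t\<bar> \<Longrightarrow> g t = 0"
    note [measurable] = borel_measurable_integrable[OF g]
    let ?M1 = "std_normal_distribution"
    let ?M2 = "density lborel (\<lambda>v. ennreal (indicator {-R..R} v)) :: real measure"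
    let ?M = "?M1 \<Otimes>\<^sub>M ?M2"
    interpret M1: prob_space ?M1 by (rule prob_space_normal_density) simp
    interpret M2: finite_measure ?M2
    proof
      have "emeasure ?M2 (space ?M2) = (\<integral>\<^sup>+v. indicator {-R..R} v \<partial>lborel)"
        by (subst emeasure_density) (auto intro!: nn_integral_cong simp: ennreal_indicator)
      also have "\<dots> < \<infinity>" using R by simp
      finally show "emeasure ?M2 (space ?M2) \<noteq> \<infinity>" by simp
    qed
    interpret M12: pair_sigma_finite ?M1 ?M2 ..
    have fin: "finite_measure ?M"
      by (rule finite_measure_pair_measure) (rule M1.finite_measure_axioms M2.finite_measure_axioms)+
    define E where "E = (\<lambda>(w, z). exp (\<i> * complex_of_real (lam * (fst w * ((fst z)\<^sup>2 + (snd z)\<^sup>2) + (snd w)\<^sup>2 * (fst z + snd z)))))"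
    let ?G = "\<lambda>z. g (fst z) * g (snd z)"
    have E_meas: "E \<in> borel_measurable (?M \<Otimes>\<^sub>M ?L2)"
      unfolding E_def by measurable
    have oscE: "cmod (osc lam g w) ^ 4 = (cmod (\<integral>z. E (w, z) * ?G z \<partial>?L2))\<^sup>2" for w
    proof -
      have sq: "(osc lam g w)\<^sup>2 = (\<integral>z. E (w, z) * ?G z \<partial>?L2)"
        unfolding E_def prod.case by (rule osc_square[OF g])
      show ?thesis unfolding sq[symmetric] by (simp add: norm_power)
    qed
    have ker: "cmod (\<integral>w. E (w, z) * cnj (E (w, z')) \<partial>?M)
      \<le> hkernel R lam ((fst z)\<^sup>2 + (snd z)\<^sup>2 - ((fst z')\<^sup>2 + (snd z')\<^sup>2)) (fst z + snd z - (fst z' + snd z'))"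
      (is "_ \<le> hkernel R lam ?p ?q") for z z'
    proof -
      \<comment> \<open>The phase difference lam (u p + v^2 q) separates, so the integral over the
        product measure factors into one in u and one in v.\<close>
      let ?e1 = "\<lambda>u. exp (\<i> * complex_of_real (lam * ?p * u))"
      let ?e2 = "\<lambda>v. exp (\<i> * complex_of_real (lam * (v\<^sup>2 * ?q)))"
      have "(\<integral>w. E (w, z) * cnj (E (w, z')) \<partial>?M) = (\<integral>w. ?e1 (fst w) * ?e2 (snd w) \<partial>?M)"
        by (intro Bochner_Integration.integral_cong) (auto simp: E_def exp_cnj algebra_simps simp flip: exp_add)
      also have "\<dots> = (\<integral>u. ?e1 u \<partial>?M1) * (\<integral>v. ?e2 v \<partial>?M2)"
        by (intro integrable_product(2) M1.sigma_finite_measure_axioms M2.sigma_finite_measure_axioms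
             M1.integrable_const_bound[where B=1] M2.integrable_const_bound[where B=1]) auto
      also have "(\<integral>u. ?e1 u \<partial>?M1) = char ?M1 (lam * ?p)"
        by (simp add: char_def)
      also have "\<dots> = complex_of_real (exp (- (lam * ?p)\<^sup>2 / 2))"
        by (simp only: char_std_normal_distribution)
      finally have "cmod (\<integral>w. E (w, z) * cnj (E (w, z')) \<partial>?M) = exp (- (lam * ?p)\<^sup>2 / 2) * cmod (\<integral>v. ?e2 v \<partial>?M2)"
        by (simp only: norm_mult norm_of_real abs_exp_cancel)
      also have "\<dots> \<le> hkernel R lam ?p ?q"
        unfolding hkernel_def using R lam by (intro mult_left_mono fresnel_bound) auto
      finally show ?thesis .
    qed
    have "(\<integral>\<^sup>+w. ennreal (indicator {-R..R} (fst w) * indicator {-R..R} (snd w) * cmod (osc lam g w) ^ 4) \<partial>?L2)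
      \<le> (\<integral>\<^sup>+w. ennreal W * ((ennreal (std_normal_density (fst w)) * ennreal (indicator {-R..R} (snd w)))
           * ennreal (cmod (osc lam g w) ^ 4)) \<partial>?L2)"
    proof (rule nn_integral_mono)
      fix w :: "real \<times> real"
      have "indicator {-R..R} (fst w) \<le> W * std_normal_density (fst w)"
      proof (cases "fst w \<in> {-R..R}")
        case True
        then have "(fst w)\<^sup>2 \<le> R\<^sup>2" by (intro power2_le_iff_abs_le[THEN iffD2]) auto
        then have "1 \<le> exp (R\<^sup>2 / 2) * exp (- (fst w)\<^sup>2 / 2)" by (simp flip: exp_add)
        then show ?thesis using True by (simp add: W_def std_normal_density_def)
      qed (simp add: W)
      then have "indicator {-R..R} (fst w) * indicator {-R..R} (snd w) * cmod (osc lam g w) ^ 4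
        \<le> W * std_normal_density (fst w) * indicator {-R..R} (snd w) * cmod (osc lam g w) ^ 4"
        by (intro mult_right_mono) auto
      then show "ennreal (indicator {-R..R} (fst w) * indicator {-R..R} (snd w) * cmod (osc lam g w) ^ 4)
        \<le> ennreal W * ((ennreal (std_normal_density (fst w)) * ennreal (indicator {-R..R} (snd w))) * ennreal (cmod (osc lam g w) ^ 4))"
        using W by (simp add: mult.assoc ennreal_leI flip: ennreal_mult' ennreal_mult'')
    qed
    also have "\<dots> = ennreal W * (\<integral>\<^sup>+w. (ennreal (std_normal_density (fst w)) * ennreal (indicator {-R..R} (snd w)))
           * ennreal (cmod (osc lam g w) ^ 4) \<partial>?L2)"
      unfolding osc_def by (rule nn_integral_cmult) measurable
    also have "(\<integral>\<^sup>+w. (ennreal (std_normal_density (fst w)) * ennreal (indicator {-R..R} (snd w)))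
           * ennreal (cmod (osc lam g w) ^ 4) \<partial>?L2) = (\<integral>\<^sup>+w. ennreal (cmod (osc lam g w) ^ 4) \<partial>?M)"
      by (subst pair_measure_density)
         (auto simp: osc_def case_prod_unfold nn_integral_density sigma_finite_lborel M1.sigma_finite_measure_axioms M2.sigma_finite_measure_axioms)
    also have "\<dots> = (\<integral>\<^sup>+w. ennreal ((cmod (\<integral>z. E (w, z) * ?G z \<partial>?L2))\<^sup>2) \<partial>?M)"
      by (simp only: oscE)
    also have "\<dots> \<le> (\<integral>\<^sup>+z. (\<integral>\<^sup>+z'. ennreal (cmod (?G z) * cmod (?G z') * cmod (\<integral>w. E (w, z) * cnj (E (w, z')) \<partial>?M)) \<partial>?L2) \<partial>?L2)"
    proof (rule nn_integral_square_oscillatory_le[OF fin _ E_meas])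
      show "sigma_finite_measure ?L2" by (simp add: lborel_prod sigma_finite_lborel)
      show "integrable ?L2 ?G" by (intro integrable_product(1) g sigma_finite_lborel)
    qed (auto simp: E_def)
    also have "\<dots> \<le> (\<integral>\<^sup>+z. (\<integral>\<^sup>+z'. ennreal (cmod (g (fst z)) * cmod (g (snd z)) * (cmod (g (fst z')) * cmod (g (snd z'))) *
        hkernel R lam ((fst z)\<^sup>2 + (snd z)\<^sup>2 - ((fst z')\<^sup>2 + (snd z')\<^sup>2)) (fst z + snd z - (fst z' + snd z'))) \<partial>?L2) \<partial>?L2)"
      unfolding norm_mult by (intro nn_integral_mono ennreal_leI mult_left_mono ker) auto
    also have "\<dots> \<le> ennreal (B * lam powr (-3/2)) * (\<integral>\<^sup>+t. ennreal (cmod (g t) ^ 4) \<partial>lborel)"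
      using lam supp by (intro B(2)) auto
    also have "ennreal W * (ennreal (B * lam powr (-3/2)) * (\<integral>\<^sup>+t. ennreal (cmod (g t) ^ 4) \<partial>lborel))
       = ennreal (W * B * lam powr (-3/2)) * (\<integral>\<^sup>+t. ennreal (cmod (g t) ^ 4) \<partial>lborel)"
      using W B(1) by (simp add: ennreal_mult mult.assoc)
    finally show "(\<integral>\<^sup>+w. ennreal (indicator {-R..R} (fst w) * indicator {-R..R} (snd w) * cmod (osc lam g w) ^ 4) \<partial>?L2)
      \<le> ennreal (W * B * lam powr (-3/2)) * (\<integral>\<^sup>+t. ennreal (cmod (g t) ^ 4) \<partial>lborel)"
      by (simp add: mult_left_mono)
  qed
qed

section \<open>Change of variables and directional derivatives\<close>

lemma nn_integral_affine_inverse: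
  fixes F :: "real \<Rightarrow> ennreal"
  assumes "F \<in> borel_measurable borel" "c \<noteq> 0"
  shows "(\<integral>\<^sup>+x. F (t + c * x) \<partial>lborel) = ennreal (1 / \<bar>c\<bar>) * (\<integral>\<^sup>+x. F x \<partial>lborel)"
proof -
  have "ennreal (1 / \<bar>c\<bar>) * (\<integral>\<^sup>+x. F x \<partial>lborel) = (ennreal (1 / \<bar>c\<bar>) * ennreal \<bar>c\<bar>) * (\<integral>\<^sup>+x. F (t + c * x) \<partial>lborel)"
    by (subst nn_integral_real_affine[OF assms, of t]) (simp add: mult.assoc)
  also have "ennreal (1 / \<bar>c\<bar>) * ennreal \<bar>c\<bar> = 1"
    using assms(2) by (simp flip: ennreal_mult')
  finally show ?thesis by simp
qed

text \<open>One variable at a time: u = a x + b y replaces x for fixed y, and then v = (c / a) u +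
  (D / a) y replaces y for fixed u. The factors 1 / |a| and |a| / |D| multiply to 1 / |D|.\<close>

lemma nn_integral_linear_change2_aux:
  fixes h :: "real \<times> real \<Rightarrow> ennreal" and a b c d :: real
  assumes [measurable]: "h \<in> borel_measurable (borel \<Otimes>\<^sub>M borel)" and D: "a * d - b * c \<noteq> 0" and a: "a \<noteq> 0"
  shows "(\<integral>\<^sup>+z. h (a * fst z + b * snd z, c * fst z + d * snd z) \<partial>(lborel \<Otimes>\<^sub>M lborel))
    = ennreal (1 / \<bar>a * d - b * c\<bar>) * (\<integral>\<^sup>+z. h z \<partial>(lborel \<Otimes>\<^sub>M lborel))"
proof -
  let ?D = "a * d - b * c"
  have "(\<integral>\<^sup>+z. h (a * fst z + b * snd z, c * fst z + d * snd z) \<partial>(lborel \<Otimes>\<^sub>M lborel))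
    = (\<integral>\<^sup>+y. (\<integral>\<^sup>+x. h (a * x + b * y, c * x + d * y) \<partial>lborel) \<partial>lborel)"
    by (subst lborel_pair.nn_integral_snd[symmetric]) auto
  also have "\<dots> = (\<integral>\<^sup>+y. ennreal (1 / \<bar>a\<bar>) * (\<integral>\<^sup>+u. h (u, c / a * u + ?D / a * y) \<partial>lborel) \<partial>lborel)"
  proof (rule nn_integral_cong)
    fix y
    have "b * y + a * x = a * x + b * y" "c / a * (a * x + b * y) + ?D / a * y = c * x + d * y" for x
      using a by (simp_all add: field_simps)
    note e = this
    have "(\<integral>\<^sup>+x. h (b * y + a * x, c / a * (b * y + a * x) + ?D / a * y) \<partial>lborel)
      = ennreal (1 / \<bar>a\<bar>) * (\<integral>\<^sup>+u. h (u, c / a * u + ?D / a * y) \<partial>lborel)"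
      using a by (intro nn_integral_affine_inverse) auto
    then show "(\<integral>\<^sup>+x. h (a * x + b * y, c * x + d * y) \<partial>lborel)
      = ennreal (1 / \<bar>a\<bar>) * (\<integral>\<^sup>+u. h (u, c / a * u + ?D / a * y) \<partial>lborel)"
      unfolding e .
  qed
  also have "\<dots> = ennreal (1 / \<bar>a\<bar>) * (\<integral>\<^sup>+y. (\<integral>\<^sup>+u. h (u, c / a * u + ?D / a * y) \<partial>lborel) \<partial>lborel)"
    by (rule nn_integral_cmult) measurable
  also have "(\<integral>\<^sup>+y. (\<integral>\<^sup>+u. h (u, c / a * u + ?D / a * y) \<partial>lborel) \<partial>lborel)
    = (\<integral>\<^sup>+u. (\<integral>\<^sup>+y. h (u, c / a * u + ?D / a * y) \<partial>lborel) \<partial>lborel)"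
    by (rule lborel_pair.Fubini', measurable)
  also have "\<dots> = (\<integral>\<^sup>+u. ennreal (1 / \<bar>?D / a\<bar>) * (\<integral>\<^sup>+v. h (u, v) \<partial>lborel) \<partial>lborel)"
    using a D by (intro nn_integral_cong nn_integral_affine_inverse) auto
  also have "\<dots> = ennreal (1 / \<bar>?D / a\<bar>) * (\<integral>\<^sup>+u. (\<integral>\<^sup>+v. h (u, v) \<partial>lborel) \<partial>lborel)"
    by (rule nn_integral_cmult) measurable
  also have "(\<integral>\<^sup>+u. (\<integral>\<^sup>+v. h (u, v) \<partial>lborel) \<partial>lborel) = (\<integral>\<^sup>+z. h z \<partial>(lborel \<Otimes>\<^sub>M lborel))"
    by (rule lborel.nn_integral_fst) measurable
  also have "ennreal (1 / \<bar>a\<bar>) * (ennreal (1 / \<bar>?D / a\<bar>) * (\<integral>\<^sup>+z. h z \<partial>(lborel \<Otimes>\<^sub>M lborel)))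
    = ennreal (1 / \<bar>?D\<bar>) * (\<integral>\<^sup>+z. h z \<partial>(lborel \<Otimes>\<^sub>M lborel))"
    using a by (simp add: abs_divide flip: mult.assoc ennreal_mult')
  finally show ?thesis .
qed

text \<open>If a = 0 the roles of x and y are exchanged. The leading entry is then b, which is
  nonzero because the determinant is -b c, and the determinant changes only its sign.\<close>

lemma nn_integral_linear_change2:
  fixes h :: "real \<times> real \<Rightarrow> ennreal" and a b c d :: real
  assumes h [measurable]: "h \<in> borel_measurable (borel \<Otimes>\<^sub>M borel)" and D: "a * d - b * c \<noteq> 0"
  shows "(\<integral>\<^sup>+z. h (a * fst z + b * snd z, c * fst z + d * snd z) \<partial>(lborel \<Otimes>\<^sub>M lborel))
    = ennreal (1 / \<bar>a * d - b * c\<bar>) * (\<integral>\<^sup>+z. h z \<partial>(lborel \<Otimes>\<^sub>M lborel))"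
proof (cases "a = 0")
  case False
  then show ?thesis by (rule nn_integral_linear_change2_aux[OF h D])
next
  case True
  have "(\<integral>\<^sup>+z. h (a * fst z + b * snd z, c * fst z + d * snd z) \<partial>(lborel \<Otimes>\<^sub>M lborel))
    = (\<integral>\<^sup>+y. (\<integral>\<^sup>+x. h (a * x + b * y, c * x + d * y) \<partial>lborel) \<partial>lborel)"
    by (subst lborel_pair.nn_integral_snd[symmetric]) auto
  also have "\<dots> = (\<integral>\<^sup>+z. h (b * fst z + a * snd z, d * fst z + c * snd z) \<partial>(lborel \<Otimes>\<^sub>M lborel))"
    by (subst lborel.nn_integral_fst[symmetric]) (auto simp: add.commute)
  also have "\<dots> = ennreal (1 / \<bar>b * c - a * d\<bar>) * (\<integral>\<^sup>+z. h z \<partial>(lborel \<Otimes>\<^sub>M lborel))"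
    using D True by (intro nn_integral_linear_change2_aux h) auto
  finally show ?thesis by (simp add: abs_minus_commute)
qed

text \<open>Hoelder's inequality with exponents 4/3 and 4, obtained by two applications of
  Cauchy-Schwarz.\<close>

lemma nn_integral_power4_le:
  fixes F :: "'a \<Rightarrow> ennreal"
  assumes [measurable]: "A \<in> sets M" "F \<in> borel_measurable M"
  shows "(\<integral>\<^sup>+x. indicator A x * F x \<partial>M) ^ 4 \<le> emeasure M A ^ 3 * (\<integral>\<^sup>+x. indicator A x * F x ^ 4 \<partial>M)"
proof -
  have sq: "(\<integral>\<^sup>+x. indicator A x * G x \<partial>M)\<^sup>2 \<le> emeasure M A * (\<integral>\<^sup>+x. indicator A x * (G x)\<^sup>2 \<partial>M)"
    if [measurable]: "G \<in> borel_measurable M" for G :: "'a \<Rightarrow> ennreal"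
  proof -
    have "(\<integral>\<^sup>+x. indicator A x * G x \<partial>M)\<^sup>2 = (\<integral>\<^sup>+x. indicator A x * (indicator A x * G x) \<partial>M)\<^sup>2"
      by (intro arg_cong[of _ _ "\<lambda>x. x\<^sup>2"] nn_integral_cong) (auto simp: indicator_def)
    also have "\<dots> \<le> (\<integral>\<^sup>+x. (indicator A x)\<^sup>2 \<partial>M) * (\<integral>\<^sup>+x. (indicator A x * G x)\<^sup>2 \<partial>M)"
      by (rule Cauchy_Schwarz_nn_integral) measurable
    also have "(\<integral>\<^sup>+x. (indicator A x)\<^sup>2 \<partial>M) = (\<integral>\<^sup>+x. indicator A x \<partial>M)"
      by (intro nn_integral_cong) (auto simp: indicator_def)
    also have "(\<integral>\<^sup>+x. (indicator A x * G x)\<^sup>2 \<partial>M) = (\<integral>\<^sup>+x. indicator A x * (G x)\<^sup>2 \<partial>M)"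
      by (intro nn_integral_cong) (auto simp: indicator_def)
    finally show ?thesis by simp
  qed
  have "(\<integral>\<^sup>+x. indicator A x * F x \<partial>M) ^ 4 = ((\<integral>\<^sup>+x. indicator A x * F x \<partial>M)\<^sup>2)\<^sup>2"
    by (simp flip: power_mult)
  also have "\<dots> \<le> (emeasure M A * (\<integral>\<^sup>+x. indicator A x * (F x)\<^sup>2 \<partial>M))\<^sup>2"
    by (intro power_mono sq) auto
  also have "\<dots> = (emeasure M A)\<^sup>2 * (\<integral>\<^sup>+x. indicator A x * (F x)\<^sup>2 \<partial>M)\<^sup>2"
    by (simp add: power_mult_distrib)
  also have "\<dots> \<le> (emeasure M A)\<^sup>2 * (emeasure M A * (\<integral>\<^sup>+x. indicator A x * ((F x)\<^sup>2)\<^sup>2 \<partial>M))"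
    by (intro mult_left_mono sq) auto
  also have "\<dots> = emeasure M A ^ 3 * (\<integral>\<^sup>+x. indicator A x * F x ^ 4 \<partial>M)"
    by (simp add: power2_eq_square power3_eq_cube mult.assoc numeral_eq_Suc)
  finally show ?thesis .
qed

lemma has_vector_derivative_along_line:
  fixes f :: "'a::euclidean_space \<Rightarrow> complex"
  assumes "f differentiable (at (z + x *\<^sub>R e))"
  shows "((\<lambda>x. f (z + x *\<^sub>R e)) has_vector_derivative frechet_derivative f (at (z + x *\<^sub>R e)) e) (at x within S)"
proof -
  let ?f' = "frechet_derivative f (at (z + x *\<^sub>R e))"
  have f': "(f has_derivative ?f') (at (z + x *\<^sub>R e))"
    using assms frechet_derivative_works by blast
  have "((\<lambda>x. z + x *\<^sub>R e) has_derivative (\<lambda>h. h *\<^sub>R e)) (at x within S)"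
    by (auto intro!: derivative_eq_intros)
  from has_derivative_compose[OF this f']
  have "((\<lambda>x. f (z + x *\<^sub>R e)) has_derivative (\<lambda>h. ?f' (h *\<^sub>R e))) (at x within S)" .
  moreover have "?f' (h *\<^sub>R e) = h *\<^sub>R ?f' e" for h
    by (rule linear_cmul[OF has_derivative_linear[OF f']])
  ultimately show ?thesis unfolding has_vector_derivative_def by simp
qed

lemma integral_directional_derivative:
  fixes f :: "'a::euclidean_space \<Rightarrow> complex"
  assumes f: "\<And>x. f differentiable (at x)" and cont: "continuous_on UNIV (\<lambda>x. frechet_derivative f (at x) e)"
    and rs: "r \<le> s"
  shows "(\<integral>x. indicator {r..s} x *\<^sub>R frechet_derivative f (at (z + x *\<^sub>R e)) e \<partial>lborel) = f (z + s *\<^sub>R e) - f (z + r *\<^sub>R e)"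
proof (rule integral_FTC_Icc[OF rs has_vector_derivative_along_line[OF f]])
  show "continuous_on {r..s} (\<lambda>x. frechet_derivative f (at (z + x *\<^sub>R e)) e)"
    by (rule continuous_on_compose2[OF cont]) (auto intro!: continuous_intros)
qed

text \<open>Shows that the derivative in v vanishes on a face of the box: the whole line in that
  direction lies where the amplitude is zero.\<close>

lemma frechet_derivative_zero_along_line:
  fixes f :: "'a::euclidean_space \<Rightarrow> complex"
  assumes f: "f differentiable (at z)" and 0: "\<And>x. f (z + x *\<^sub>R e) = 0"
  shows "frechet_derivative f (at z) e = 0"
proof -
  have "((\<lambda>x::real. 0) has_vector_derivative frechet_derivative f (at z) e) (at 0)"
    using has_vector_derivative_along_line[of f z 0 e UNIV] f by (simp add: 0)
  then show ?thesis
    using vector_derivative_unique_at has_vector_derivative_const by blast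
qed

section \<open>The upper bound\<close>

text \<open>The pointwise inequality x <= 1 + x^4 takes the place of Hoelder on the bounded
  interval.\<close>

lemma integrable_on_box_of_L4:
  fixes f :: "real \<Rightarrow> complex"
  assumes [measurable]: "f \<in> borel_measurable borel" and fin: "(\<integral>\<^sup>+t. ennreal (cmod (f t) ^ 4) \<partial>lborel) < \<infinity>"
  shows "integrable lborel (\<lambda>t. indicator {-R..R} t *\<^sub>R f t)"
proof (rule integrableI_bounded)
  have le: "x \<le> 1 + x ^ 4" if "0 \<le> x" for x :: real
    using that power_increasing[of 1 4 x] by (cases "x \<le> 1") (auto intro: add_increasing2 add_increasing)
  have "(\<integral>\<^sup>+t. ennreal (cmod (indicator {-R..R} t *\<^sub>R f t)) \<partial>lborel)
    \<le> (\<integral>\<^sup>+t. indicator {-R..R} t + ennreal (cmod (f t) ^ 4) \<partial>lborel)"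
  proof (rule nn_integral_mono)
    fix t
    show "ennreal (cmod (indicator {-R..R} t *\<^sub>R f t)) \<le> indicator {-R..R} t + ennreal (cmod (f t) ^ 4)"
      using le[of "cmod (f t)"] by (cases "t \<in> {-R..R}") (auto simp flip: ennreal_1 ennreal_plus intro!: ennreal_leI)
  qed
  also have "\<dots> = (\<integral>\<^sup>+t. indicator {-R..R} t \<partial>lborel) + (\<integral>\<^sup>+t. ennreal (cmod (f t) ^ 4) \<partial>lborel)"
    by (rule nn_integral_add) auto
  also have "\<dots> < \<infinity>"
    using fin emeasure_bounded_finite[of "{-R..R}"] by (simp add: less_top)
  finally show "(\<integral>\<^sup>+t. ennreal (norm (indicator {-R..R} t *\<^sub>R f t)) \<partial>lborel) < \<infinity>" by simp
qed simp

text \<open>By \<open>rep\<close>, the operator at w is a superposition over z of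
  \<open>osc lam (g z) w\<close>, with weights that depend on w only through the quadrant conditions
  z1 <= u, z2 <= v. Bounding these weights by 1 leaves the integral of |osc lam (g z) w| over z in
  the box. The fourth power then passes inside by \<open>nn_integral_power4_le\<close>, and
  \<open>osc_L4_bound\<close> applies for each fixed z.\<close>

lemma straightened_upper_bound:
  fixes h \<Psi> :: "real \<times> real \<times> real \<Rightarrow> complex"
  assumes R: "1 \<le> R" and h: "continuous_on UNIV h"
    and rep: "\<And>u v t. u \<in> {-R..R} \<Longrightarrow> v \<in> {-R..R} \<Longrightarrow>
      \<Psi> (u, v, t) = (\<integral>z. (indicator {-R..u} (fst z) * indicator {-R..v} (snd z)) *\<^sub>R h (fst z, snd z, t) \<partial>(lborel \<Otimes>\<^sub>M lborel))"
    and supp: "\<And>u v t. R < \<bar>u\<bar> \<or> R < \<bar>v\<bar> \<or> R < \<bar>t\<bar> \<Longrightarrow> \<Psi> (u, v, t) = 0"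
  obtains C where "0 \<le> C" "\<And>lam f. 0 < lam \<Longrightarrow> f \<in> borel_measurable borel \<Longrightarrow>
      (\<integral>\<^sup>+t. ennreal (cmod (f t) ^ 4) \<partial>lborel) < \<infinity> \<Longrightarrow>
      (\<integral>\<^sup>+w. ennreal (cmod (\<integral>t. exp (\<i> * complex_of_real (lam * (fst w * t\<^sup>2 + (snd w)\<^sup>2 * t))) * \<Psi> (fst w, snd w, t) * f t \<partial>lborel) ^ 4) \<partial>(lborel \<Otimes>\<^sub>M lborel))
      \<le> ennreal (C * lam powr (-3/2)) * (\<integral>\<^sup>+t. ennreal (cmod (f t) ^ 4) \<partial>lborel)"
proof (rule osc_L4_bound[OF R])
  let ?L2 = "lborel \<Otimes>\<^sub>M lborel :: (real \<times> real) measure"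
  have sf: "sigma_finite_measure ?L2" by (simp add: lborel_prod sigma_finite_lborel)
  interpret LL: pair_sigma_finite "lborel :: real measure" ?L2
    using sf by (simp add: pair_sigma_finite_def sigma_finite_lborel)
  interpret L22: pair_sigma_finite ?L2 ?L2
    using sf by (simp add: pair_sigma_finite_def)
  have [measurable]: "h \<in> borel_measurable (borel \<Otimes>\<^sub>M borel \<Otimes>\<^sub>M borel)"
    using borel_measurable_continuous_onI[OF h] by (simp add: borel_prod)
  fix C assume C: "0 \<le> C" "\<And>lam g. 0 < lam \<Longrightarrow> integrable lborel g \<Longrightarrow> (\<And>t. R < \<bar>t\<bar> \<Longrightarrow> g t = 0) \<Longrightarrow>
     (\<integral>\<^sup>+w. ennreal (indicator {-R..R} (fst w) * indicator {-R..R} (snd w) * cmod (osc lam g w) ^ 4) \<partial>?L2)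
     \<le> ennreal (C * lam powr (-3/2)) * (\<integral>\<^sup>+t. ennreal (cmod (g t) ^ 4) \<partial>lborel)"
  obtain H where H: "0 \<le> H" "\<And>u v t. \<lbrakk>u \<in> {-R..R}; v \<in> {-R..R}; t \<in> {-R..R}\<rbrakk> \<Longrightarrow> cmod (h (u, v, t)) \<le> H"
  proof -
    have "compact (h ` ({-R..R} \<times> {-R..R} \<times> {-R..R}))"
      by (intro compact_continuous_image continuous_on_subset[OF h] compact_Times) auto
    then obtain H where "\<forall>x\<in>h ` ({-R..R} \<times> {-R..R} \<times> {-R..R}). norm x \<le> H"
      using compact_imp_bounded bounded_iff by metis
    then show thesis by (intro that[of "max H 0"]) (auto simp: le_max_iff_disj)
  qed
  define Bx where "Bx = {-R..R} \<times> {-R..R}"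
  have [measurable]: "Bx \<in> sets (borel \<Otimes>\<^sub>M borel)" "Bx \<in> sets ?L2" by (simp_all add: Bx_def)
  have mBx: "emeasure ?L2 Bx = ennreal (4 * R\<^sup>2)"
    using R by (simp add: Bx_def lborel.emeasure_pair_measure_Times power2_eq_square flip: ennreal_mult')
  have iBx: "indicator {-R..R} (fst z) * indicator {-R..R} (snd z) = (indicator Bx z :: real)" for z
    by (cases z) (auto simp: Bx_def indicator_def)
  show thesis
  proof (rule that)
    \<comment> \<open>4 R^2 is the area of the box: three powers come from Hoelder in z and one from
      the final integration over z. H bounds h on the cube, so H^4 compares \<open>g z\<close> with
      f.\<close>
    show "0 \<le> (4 * R\<^sup>2) ^ 4 * C * H ^ 4" using C H by simp
  next
    fix lam :: real and f :: "real \<Rightarrow> complex"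
    assume lam: "0 < lam" and f [measurable]: "f \<in> borel_measurable borel"
      and fin: "(\<integral>\<^sup>+t. ennreal (cmod (f t) ^ 4) \<partial>lborel) < \<infinity>"
    let ?e = "\<lambda>w t. exp (\<i> * complex_of_real (lam * (fst w * t\<^sup>2 + (snd w)\<^sup>2 * t)))"
    define T where "T = (\<lambda>w. \<integral>t. ?e w t * \<Psi> (fst w, snd w, t) * f t \<partial>lborel)"
    define g where "g = (\<lambda>z t. indicator {-R..R} t *\<^sub>R (h (fst z, snd z, t) * f t))"
    have [measurable]: "(\<lambda>x. osc lam (g (snd x)) (fst x)) \<in> borel_measurable (?L2 \<Otimes>\<^sub>M ?L2)"
      "(\<lambda>x. osc lam (g (fst x)) (snd x)) \<in> borel_measurable (?L2 \<Otimes>\<^sub>M ?L2)"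
      unfolding osc_def g_def by measurable
    have [measurable]: "(\<lambda>z. osc lam (g z) w) \<in> borel_measurable ?L2" for w
      unfolding osc_def g_def by measurable
    have int_f: "integrable lborel (\<lambda>t. indicator {-R..R} t *\<^sub>R f t)"
      by (rule integrable_on_box_of_L4[OF f fin])
    have int_g: "integrable lborel (g z)" if "z \<in> Bx" for z
    proof (rule Bochner_Integration.integrable_bound)
      show "integrable lborel (\<lambda>t. H *\<^sub>R (indicator {-R..R} t *\<^sub>R f t))" by (intro integrable_scaleR_right int_f)
      show "g z \<in> borel_measurable lborel" unfolding g_def by measurable
      show "AE t in lborel. norm (g z t) \<le> norm (H *\<^sub>R (indicator {-R..R} t *\<^sub>R f t))"
        using that H by (intro AE_I2) (auto simp: g_def Bx_def norm_mult indicator_def intro!: mult_right_mono)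
    qed
    have T_le: "ennreal (cmod (T w)) \<le> (\<integral>\<^sup>+z. indicator Bx z * ennreal (cmod (osc lam (g z) w)) \<partial>?L2)" if w: "w \<in> Bx" for w
    proof -
      define q where "q = (\<lambda>z. indicator {-R..fst w} (fst z) * indicator {-R..snd w} (snd z) :: real)"
      have q: "q z \<le> indicator Bx z" "0 \<le> q z" for z
        using w by (cases z; auto simp: q_def Bx_def indicator_def)+
      define F where "F = (\<lambda>t z. (?e w t * (indicator {-R..R} t *\<^sub>R f t)) * (q z *\<^sub>R h (fst z, snd z, t)))"
      have intF: "integrable (lborel \<Otimes>\<^sub>M ?L2) (case_prod F)"
      proof (rule Bochner_Integration.integrable_bound)
        have "integrable ?L2 (\<lambda>z. H * indicator Bx z :: real)"
          using mBx by (intro integrable_mult_right integrable_real_indicator) auto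
        then show "integrable (lborel \<Otimes>\<^sub>M ?L2) (\<lambda>x. cmod (indicator {-R..R} (fst x) *\<^sub>R f (fst x)) * (H * indicator Bx (snd x)))"
          by (intro integrable_product(1) sf sigma_finite_lborel integrable_norm int_f)
        show "case_prod F \<in> borel_measurable (lborel \<Otimes>\<^sub>M ?L2)"
          unfolding F_def q_def by measurable
        show "AE x in lborel \<Otimes>\<^sub>M ?L2. norm (case_prod F x)
          \<le> norm (cmod (indicator {-R..R} (fst x) *\<^sub>R f (fst x)) * (H * indicator Bx (snd x)))"
        proof (rule AE_I2)
          fix x :: "real \<times> real \<times> real"
          obtain t z where x: "x = (t, z)" by (cases x)
          show "norm (case_prod F x) \<le> norm (cmod (indicator {-R..R} (fst x) *\<^sub>R f (fst x)) * (H * indicator Bx (snd x)))"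
          proof (cases "t \<in> {-R..R} \<and> z \<in> Bx")
            case True
            then have "cmod (h (fst z, snd z, t)) \<le> H" by (intro H) (auto simp: Bx_def)
            moreover have "q z \<le> 1" "0 \<le> q z" using q[of z] True by auto
            ultimately have "\<bar>q z\<bar> * cmod (h (fst z, snd z, t)) \<le> 1 * H"
              by (intro mult_mono) auto
            then have "cmod (f t) * (\<bar>q z\<bar> * cmod (h (fst z, snd z, t))) \<le> cmod (f t) * (1 * H)"
              by (rule mult_left_mono) simp
            then show ?thesis
              using True H(1) by (simp add: x F_def norm_mult mult.left_commute)
          next
            case False
            then have "t \<notin> {-R..R} \<or> q z = 0" using q[of z] by (auto simp: indicator_def split: if_splits)
            then show ?thesis by (auto simp: x F_def)
          qed
        qed
      qed
      have "T w = (\<integral>t. (\<integral>z. F t z \<partial>?L2) \<partial>lborel)"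
        unfolding T_def
      proof (rule Bochner_Integration.integral_cong[OF refl])
        fix t
        have "(\<integral>z. F t z \<partial>?L2) = (?e w t * (indicator {-R..R} t *\<^sub>R f t)) * (\<integral>z. q z *\<^sub>R h (fst z, snd z, t) \<partial>?L2)"
          unfolding F_def by (rule integral_mult_right_zero)
        also have "(\<integral>z. q z *\<^sub>R h (fst z, snd z, t) \<partial>?L2) = \<Psi> (fst w, snd w, t)"
          unfolding q_def using w by (intro rep[symmetric]) (auto simp: Bx_def)
        finally have "(\<integral>z. F t z \<partial>?L2) = (?e w t * (indicator {-R..R} t *\<^sub>R f t)) * \<Psi> (fst w, snd w, t)" .
        \<comment> \<open>For |t| > R the left side vanishes by the support of \<open>\<Psi>\<close>
          and the right side by the cutoff in t; otherwise that cutoff equals 1.\<close>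
        then show "?e w t * \<Psi> (fst w, snd w, t) * f t = (\<integral>z. F t z \<partial>?L2)"
          using supp[of "fst w" "snd w" t] by (cases "\<bar>t\<bar> \<le> R") (auto simp: indicator_def abs_le_iff)
      qed
      also have "\<dots> = (\<integral>z. (\<integral>t. F t z \<partial>lborel) \<partial>?L2)"
        using LL.Fubini_integral[OF intF] by simp
      also have "ennreal (cmod \<dots>) \<le> (\<integral>\<^sup>+z. ennreal (cmod (\<integral>t. F t z \<partial>lborel)) \<partial>?L2)"
        by (rule integral_norm_bound_ennreal[OF LL.integrable_snd[OF intF]])
      also have "\<dots> \<le> (\<integral>\<^sup>+z. indicator Bx z * ennreal (cmod (osc lam (g z) w)) \<partial>?L2)"
      proof (rule nn_integral_mono)
        fix z :: "real \<times> real"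
        have "(\<integral>t. F t z \<partial>lborel) = (\<integral>t. q z *\<^sub>R (?e w t * g z t) \<partial>lborel)"
          by (rule Bochner_Integration.integral_cong[OF refl]) (simp add: F_def g_def mult_ac)
        also have "\<dots> = q z *\<^sub>R osc lam (g z) w"
          by (simp add: osc_def)
        finally have "cmod (\<integral>t. F t z \<partial>lborel) = q z * cmod (osc lam (g z) w)"
          using q[of z] by simp
        also have "\<dots> \<le> indicator Bx z * cmod (osc lam (g z) w)"
          by (intro mult_right_mono q) auto
        finally have "ennreal (cmod (\<integral>t. F t z \<partial>lborel)) \<le> ennreal (indicator Bx z * cmod (osc lam (g z) w))"
          by (rule ennreal_leI)
        then show "ennreal (cmod (\<integral>t. F t z \<partial>lborel)) \<le> indicator Bx z * ennreal (cmod (osc lam (g z) w))"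
          by (simp add: ennreal_mult' ennreal_indicator)
      qed
      finally show ?thesis .
    qed
    have T0: "T w = 0" if "w \<notin> Bx" for w
    proof -
      have "\<Psi> (fst w, snd w, t) = 0" for t
        using that by (intro supp) (cases w, auto simp: Bx_def)
      then show ?thesis by (simp add: T_def)
    qed
    have "(\<integral>\<^sup>+w. ennreal (cmod (T w) ^ 4) \<partial>?L2)
      \<le> (\<integral>\<^sup>+w. ennreal (4 * R\<^sup>2) ^ 3 * (\<integral>\<^sup>+z. indicator Bx w * (indicator Bx z * ennreal (cmod (osc lam (g z) w)) ^ 4) \<partial>?L2) \<partial>?L2)"
    proof (rule nn_integral_mono)
      fix w :: "real \<times> real"
      show "ennreal (cmod (T w) ^ 4) \<le> ennreal (4 * R\<^sup>2) ^ 3 * (\<integral>\<^sup>+z. indicator Bx w * (indicator Bx z * ennreal (cmod (osc lam (g z) w)) ^ 4) \<partial>?L2)"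
      proof (cases "w \<in> Bx")
        case True
        have "ennreal (cmod (T w) ^ 4) = ennreal (cmod (T w)) ^ 4" by (simp add: ennreal_power)
        also have "\<dots> \<le> (\<integral>\<^sup>+z. indicator Bx z * ennreal (cmod (osc lam (g z) w)) \<partial>?L2) ^ 4"
          by (intro power_mono T_le True) auto
        also have "\<dots> \<le> emeasure ?L2 Bx ^ 3 * (\<integral>\<^sup>+z. indicator Bx z * ennreal (cmod (osc lam (g z) w)) ^ 4 \<partial>?L2)"
          by (rule nn_integral_power4_le) measurable
        finally show ?thesis using True by (simp add: mBx)
      qed (simp add: T0)
    qed
    also have "\<dots> = ennreal (4 * R\<^sup>2) ^ 3 * (\<integral>\<^sup>+w. (\<integral>\<^sup>+z. indicator Bx w * (indicator Bx z * ennreal (cmod (osc lam (g z) w)) ^ 4) \<partial>?L2) \<partial>?L2)"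
      by (rule nn_integral_cmult) measurable
    also have "(\<integral>\<^sup>+w. (\<integral>\<^sup>+z. indicator Bx w * (indicator Bx z * ennreal (cmod (osc lam (g z) w)) ^ 4) \<partial>?L2) \<partial>?L2)
      = (\<integral>\<^sup>+z. (\<integral>\<^sup>+w. indicator Bx w * (indicator Bx z * ennreal (cmod (osc lam (g z) w)) ^ 4) \<partial>?L2) \<partial>?L2)"
      by (rule L22.Fubini', measurable)
    also have "\<dots> \<le> (\<integral>\<^sup>+z. ennreal (C * lam powr (-3/2) * H ^ 4) * (\<integral>\<^sup>+t. ennreal (cmod (f t) ^ 4) \<partial>lborel) * indicator Bx z \<partial>?L2)"
    proof (rule nn_integral_mono)
      fix z :: "real \<times> real"
      show "(\<integral>\<^sup>+w. indicator Bx w * (indicator Bx z * ennreal (cmod (osc lam (g z) w)) ^ 4) \<partial>?L2)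
        \<le> ennreal (C * lam powr (-3/2) * H ^ 4) * (\<integral>\<^sup>+t. ennreal (cmod (f t) ^ 4) \<partial>lborel) * indicator Bx z"
      proof (cases "z \<in> Bx")
        case True
        have "(\<integral>\<^sup>+w. indicator Bx w * (indicator Bx z * ennreal (cmod (osc lam (g z) w)) ^ 4) \<partial>?L2)
          = (\<integral>\<^sup>+w. ennreal (indicator {-R..R} (fst w) * indicator {-R..R} (snd w) * cmod (osc lam (g z) w) ^ 4) \<partial>?L2)"
          using True unfolding iBx by (intro nn_integral_cong) (simp add: ennreal_mult' ennreal_indicator ennreal_power)
        also have "\<dots> \<le> ennreal (C * lam powr (-3/2)) * (\<integral>\<^sup>+t. ennreal (cmod (g z t) ^ 4) \<partial>lborel)"
          by (intro C(2) lam int_g True) (auto simp: g_def indicator_def)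
        also have "\<dots> \<le> ennreal (C * lam powr (-3/2)) * (\<integral>\<^sup>+t. ennreal (H ^ 4) * ennreal (cmod (f t) ^ 4) \<partial>lborel)"
        proof (intro mult_left_mono nn_integral_mono)
          fix t
          have "cmod (g z t) \<le> H * cmod (f t)"
            using True H by (auto simp: g_def Bx_def norm_mult indicator_def intro!: mult_right_mono)
          then have "cmod (g z t) ^ 4 \<le> (H * cmod (f t)) ^ 4" by (intro power_mono) auto
          then show "ennreal (cmod (g z t) ^ 4) \<le> ennreal (H ^ 4) * ennreal (cmod (f t) ^ 4)"
            using H by (simp add: power_mult_distrib ennreal_leI flip: ennreal_mult')
        qed auto
        also have "\<dots> = ennreal (C * lam powr (-3/2) * H ^ 4) * (\<integral>\<^sup>+t. ennreal (cmod (f t) ^ 4) \<partial>lborel)"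
          using C H by (subst nn_integral_cmult) (auto simp: ennreal_mult mult.assoc)
        finally show ?thesis using True by simp
      qed simp
    qed
    also have "\<dots> = ennreal (C * lam powr (-3/2) * H ^ 4) * (\<integral>\<^sup>+t. ennreal (cmod (f t) ^ 4) \<partial>lborel) * ennreal (4 * R\<^sup>2)"
      by (subst nn_integral_cmult_indicator) (auto simp: mBx)
    also have "ennreal (4 * R\<^sup>2) ^ 3 * \<dots> = ennreal ((4 * R\<^sup>2) ^ 4 * C * H ^ 4 * lam powr (-3/2)) * (\<integral>\<^sup>+t. ennreal (cmod (f t) ^ 4) \<partial>lborel)"
    proof -
      have "ennreal (4 * R\<^sup>2) ^ 3 * (ennreal (C * lam powr (-3/2) * H ^ 4) * X * ennreal (4 * R\<^sup>2))
        = (ennreal (4 * R\<^sup>2) ^ 4 * ennreal (C * lam powr (-3/2) * H ^ 4)) * X" for X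
        by (simp add: mult_ac numeral_eq_Suc)
      also have "ennreal (4 * R\<^sup>2) ^ 4 * ennreal (C * lam powr (-3/2) * H ^ 4) = ennreal ((4 * R\<^sup>2) ^ 4 * C * H ^ 4 * lam powr (-3/2))"
        using C H by (simp add: ennreal_power mult_ac flip: ennreal_mult)
      finally show ?thesis .
    qed
    finally show "(\<integral>\<^sup>+w. ennreal (cmod (\<integral>t. ?e w t * \<Psi> (fst w, snd w, t) * f t \<partial>lborel) ^ 4) \<partial>?L2)
      \<le> ennreal ((4 * R\<^sup>2) ^ 4 * C * H ^ 4 * lam powr (-3/2)) * (\<integral>\<^sup>+t. ennreal (cmod (f t) ^ 4) \<partial>lborel)"
      unfolding T_def by (simp add: mult_left_mono)
  qed
qed

lemma smooth_imp_differentiable: "smooth f \<Longrightarrow> f differentiable (at x)"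
  by (metis Ck.simps(2) smooth_def)

lemma smooth_frechet_derivative: "smooth f \<Longrightarrow> smooth (\<lambda>x. frechet_derivative f (at x) v)"
  by (metis Ck.simps(2) smooth_def)

lemma smooth_imp_continuous: "smooth f \<Longrightarrow> continuous_on UNIV f"
  by (metis Ck.simps(1) smooth_def)

text \<open>In straightened coordinates the amplitude vanishes on the faces u = -R and v = -R.
  Applying the fundamental theorem of calculus in v and then in u therefore writes it as the
  integral of its mixed derivative h over a quadrant, without boundary terms. The linear change of
  variables costs the factor 1 / |a d - b c|.\<close>

lemma T_op_straight_bound:
  fixes a b c d :: real and \<psi> :: "real \<times> real \<times> real \<Rightarrow> complex"
  assumes D: "a * d - b * c \<noteq> 0" and \<psi>: "smooth \<psi>" "compactly_supported \<psi>"
  obtains C where "0 \<le> C" "\<And>lam f. 0 < lam \<Longrightarrow> f \<in> borel_measurable borel \<Longrightarrow>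
      (\<integral>\<^sup>+t. ennreal (cmod (f t) ^ 4) \<partial>lborel) < \<infinity> \<Longrightarrow>
      (\<integral>\<^sup>+z. ennreal (cmod (\<integral>t. exp (\<i> * complex_of_real (lam * ((a * fst z + b * snd z) * t\<^sup>2 + (c * fst z + d * snd z)\<^sup>2 * t)))
         * \<psi> (fst z, snd z, t) * f t \<partial>lborel) ^ 4) \<partial>(lborel \<Otimes>\<^sub>M lborel))
      \<le> ennreal (C * lam powr (-3/2)) * (\<integral>\<^sup>+t. ennreal (cmod (f t) ^ 4) \<partial>lborel)"
proof -
  let ?D = "a * d - b * c"
  let ?L2 = "lborel \<Otimes>\<^sub>M lborel :: (real \<times> real) measure"
  \<comment> \<open>inverts the coordinate change \<open>(x, y) \<mapsto> (a x + b y, c x + d y)\<close>, with \<open>eu\<close> and \<open>ev\<close> its partial derivatives\<close>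
  define L where "L = (\<lambda>(u, v, t). ((d * u - b * v) / ?D, (a * v - c * u) / ?D, t) :: real \<times> real \<times> real)"
  define eu ev where "eu = (d / ?D, - c / ?D, 0 :: real)" and "ev = (- b / ?D, a / ?D, 0 :: real)"
  \<comment> \<open>Derivatives are taken of \<open>\<psi>\<close> in the directions
    \<open>ev\<close>, \<open>eu\<close> and only then composed with \<open>L\<close>. They are the
    partial derivatives of \<open>\<Psi>\<close> in v and u, while only the continuity of
    \<open>L\<close> enters.\<close>
  define \<psi>v where "\<psi>v = (\<lambda>x. frechet_derivative \<psi> (at x) ev)"
  define h where "h = (\<lambda>x. frechet_derivative \<psi>v (at (L x)) eu)"
  define \<Psi> where "\<Psi> = \<psi> \<circ> L"
  have L_u: "L (u, v, t) = L (0, v, t) + u *\<^sub>R eu" for u v t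
    by (simp add: L_def eu_def diff_divide_distrib mult.commute)
  have L_v: "L (u, v, t) = L (u, 0, t) + v *\<^sub>R ev" for u v t
    by (simp add: L_def ev_def diff_divide_distrib mult.commute)
  have L_line: "L (u, v, t) + s *\<^sub>R ev = L (u, v + s, t)" for u v t s
    using L_v[of u v t] L_v[of u "v + s" t] by (simp add: algebra_simps)
  have L_inv: "L (a * x + b * y, c * x + d * y, t) = (x, y, t)" for x y t
  proof -
    have "d * (a * x + b * y) - b * (c * x + d * y) = x * ?D" "a * (c * x + d * y) - c * (a * x + b * y) = y * ?D"
      by (simp_all add: algebra_simps)
    then show ?thesis using D by (simp add: L_def)
  qed
  have L_fwd: "a * fst (L (u, v, t)) + b * fst (snd (L (u, v, t))) = u" "c * fst (L (u, v, t)) + d * fst (snd (L (u, v, t))) = v"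
    "snd (snd (L (u, v, t))) = t" for u v t
  proof -
    have "a * (d * u - b * v) + b * (a * v - c * u) = u * ?D" "c * (d * u - b * v) + d * (a * v - c * u) = v * ?D"
      by (simp_all add: algebra_simps)
    moreover have "p * (x / ?D) + q * (y / ?D) = (p * x + q * y) / ?D" for p q x y :: real
      by (simp add: add_divide_distrib)
    ultimately show "a * fst (L (u, v, t)) + b * fst (snd (L (u, v, t))) = u" "c * fst (L (u, v, t)) + d * fst (snd (L (u, v, t))) = v"
      "snd (snd (L (u, v, t))) = t"
      using D by (simp_all add: L_def del: times_divide_eq_right)
  qed
  have L_cont: "continuous_on UNIV L"
    unfolding L_def case_prod_unfold by (intro continuous_intros) (use D in auto)
  have smv: "smooth \<psi>v" unfolding \<psi>v_def by (rule smooth_frechet_derivative[OF \<psi>(1)])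
  have h_cont: "continuous_on UNIV h"
    unfolding h_def
    by (rule continuous_on_compose2[OF smooth_imp_continuous[OF smooth_frechet_derivative[OF smv]] L_cont]) auto
  obtain K where K: "\<And>x. \<psi> x \<noteq> 0 \<Longrightarrow> norm x \<le> K"
  proof -
    have "bounded {x. \<psi> x \<noteq> 0}"
      using \<psi>(2) compact_imp_bounded bounded_subset closure_subset unfolding compactly_supported_def by metis
    then show thesis using that unfolding bounded_iff by auto
  qed
  \<comment> \<open>On the support |x|, |y|, |t| <= |K|, which bounds u, v and t by the second
    summand. The extra 1 makes the inequality strict, so the amplitude vanishes on the faces of the
    box themselves. The modulus of K matters because K may be negative when \<open>\<psi>\<close> =
    0.\<close>
  define R where "R = 1 + (1 + \<bar>a\<bar> + \<bar>b\<bar> + \<bar>c\<bar> + \<bar>d\<bar>) * \<bar>K\<bar>"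
  have R: "1 \<le> R" by (simp add: R_def)
  have supp: "\<psi> (L (u, v, t)) = 0" if out: "R \<le> \<bar>u\<bar> \<or> R \<le> \<bar>v\<bar> \<or> R \<le> \<bar>t\<bar>" for u v t
  proof (rule ccontr)
    assume nz: "\<psi> (L (u, v, t)) \<noteq> 0"
    obtain x y s where xy: "L (u, v, t) = (x, y, s)" by (cases "L (u, v, t)")
    have n: "norm (x, y, s) \<le> \<bar>K\<bar>" using K[OF nz] by (simp add: xy)
    have "norm x \<le> norm (x, y, s)" "norm (y, s) \<le> norm (x, y, s)" "norm y \<le> norm (y, s)" "norm s \<le> norm (y, s)"
      using norm_fst_le norm_snd_le by metis+
    then have xys: "\<bar>x\<bar> \<le> \<bar>K\<bar>" "\<bar>y\<bar> \<le> \<bar>K\<bar>" "\<bar>s\<bar> \<le> \<bar>K\<bar>" using n by simp_all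
    have lin: "\<bar>p * x + q * y\<bar> \<le> \<bar>p\<bar> * \<bar>K\<bar> + \<bar>q\<bar> * \<bar>K\<bar>" for p q :: real
    proof -
      have "\<bar>p * x + q * y\<bar> \<le> \<bar>p\<bar> * \<bar>x\<bar> + \<bar>q\<bar> * \<bar>y\<bar>" by (metis abs_mult abs_triangle_ineq)
      also have "\<dots> \<le> \<bar>p\<bar> * \<bar>K\<bar> + \<bar>q\<bar> * \<bar>K\<bar>" by (intro add_mono mult_left_mono xys) auto
      finally show ?thesis .
    qed
    define k ka kb kc kd where "k = \<bar>K\<bar>" and "ka = \<bar>a\<bar> * \<bar>K\<bar>" and "kb = \<bar>b\<bar> * \<bar>K\<bar>"
      and "kc = \<bar>c\<bar> * \<bar>K\<bar>" and "kd = \<bar>d\<bar> * \<bar>K\<bar>"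
    note k_defs = this
    have nn: "0 \<le> k" "0 \<le> ka" "0 \<le> kb" "0 \<le> kc" "0 \<le> kd" by (simp_all add: k_defs)
    have RK: "R = 1 + k + ka + kb + kc + kd"
      by (simp add: R_def k_defs algebra_simps)
    have "u = a * x + b * y" "v = c * x + d * y" "t = s" using L_fwd[of u v t] by (simp_all add: xy)
    then have "\<bar>u\<bar> \<le> ka + kb" "\<bar>v\<bar> \<le> kc + kd" "\<bar>t\<bar> \<le> k"
      using lin xys by (simp_all add: k_defs)
    then have "\<bar>u\<bar> < R" "\<bar>v\<bar> < R" "\<bar>t\<bar> < R"
      unfolding RK using nn by simp_all
    then show False using out by simp
  qed
  have rep: "\<Psi> (u, v, t) = (\<integral>z. (indicator {-R..u} (fst z) * indicator {-R..v} (snd z)) *\<^sub>R h (fst z, snd z, t) \<partial>?L2)"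
    if uv: "u \<in> {-R..R}" "v \<in> {-R..R}" for u v t
  proof -
    have "(\<integral>v'. indicator {-R..v} v' *\<^sub>R \<psi>v (L (u, v', t)) \<partial>lborel) = \<psi> (L (u, v, t)) - \<psi> (L (u, -R, t))"
    proof -
      have "-R \<le> v" using uv by simp
      from integral_directional_derivative[OF smooth_imp_differentiable[OF \<psi>(1)] smooth_imp_continuous[OF smv, unfolded \<psi>v_def] this, of "L (u, 0, t)"]
      show ?thesis unfolding L_v[symmetric] \<psi>v_def .
    qed
    also have "\<psi> (L (u, -R, t)) = 0" using R by (intro supp) auto
    finally have 1: "\<Psi> (u, v, t) = (\<integral>v'. indicator {-R..v} v' *\<^sub>R \<psi>v (L (u, v', t)) \<partial>lborel)"
      by (simp add: \<Psi>_def)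
    have 2: "\<psi>v (L (u, v', t)) = (\<integral>u'. indicator {-R..u} u' *\<^sub>R h (u', v', t) \<partial>lborel)" for v'
    proof -
      have "(\<integral>u'. indicator {-R..u} u' *\<^sub>R h (u', v', t) \<partial>lborel) = \<psi>v (L (u, v', t)) - \<psi>v (L (-R, v', t))"
      proof -
        have "-R \<le> u" using uv by simp
        from integral_directional_derivative[OF smooth_imp_differentiable[OF smv] smooth_imp_continuous[OF smooth_frechet_derivative[OF smv, of eu]] this, of "L (0, v', t)"]
        show ?thesis unfolding L_u[symmetric] h_def .
      qed
      \<comment> \<open>Moving along \<open>ev\<close> changes v only, so the line through this
        point stays in the face u = -R, where \<open>\<psi>\<close> vanishes.\<close>
      moreover have "\<psi>v (L (-R, v', t)) = 0"
        unfolding \<psi>v_def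
      proof (rule frechet_derivative_zero_along_line[OF smooth_imp_differentiable[OF \<psi>(1)]])
        show "\<psi> (L (- R, v', t) + x *\<^sub>R ev) = 0" for x
          unfolding L_line using R by (intro supp) auto
      qed
      ultimately show ?thesis by simp
    qed
    let ?F = "\<lambda>u' v'. (indicator {-R..u} u' * indicator {-R..v} v') *\<^sub>R h (u', v', t)"
    have "integrable ?L2 (\<lambda>z. indicator ({-R..u} \<times> {-R..v}) z *\<^sub>R h (fst z, snd z, t))"
      unfolding lborel_prod
      by (intro borel_integrable_compact compact_Times continuous_on_compose2[OF h_cont] continuous_intros) auto
    then have int: "integrable ?L2 (case_prod ?F)"
      by (simp add: case_prod_unfold indicator_times)
    have "\<Psi> (u, v, t) = (\<integral>v'. (\<integral>u'. ?F u' v' \<partial>lborel) \<partial>lborel)"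
      unfolding 1 2 by (simp flip: integral_scaleR_right add: mult.commute)
    also have "\<dots> = (\<integral>z. ?F (fst z) (snd z) \<partial>?L2)"
      using lborel_pair.integral_snd[OF int] by (simp add: case_prod_unfold)
    finally show ?thesis .
  qed
  show thesis
  proof (rule straightened_upper_bound[OF R h_cont rep])
    show "\<Psi> (u, v, t) = 0" if "R < \<bar>u\<bar> \<or> R < \<bar>v\<bar> \<or> R < \<bar>t\<bar>" for u v t
      using that supp[of u v t] by (auto simp: \<Psi>_def)
  next
    fix C
    assume C: "0 \<le> C" "\<And>lam f. 0 < lam \<Longrightarrow> f \<in> borel_measurable borel \<Longrightarrow>
      (\<integral>\<^sup>+t. ennreal (cmod (f t) ^ 4) \<partial>lborel) < \<infinity> \<Longrightarrow>
      (\<integral>\<^sup>+w. ennreal (cmod (\<integral>t. exp (\<i> * complex_of_real (lam * (fst w * t\<^sup>2 + (snd w)\<^sup>2 * t))) * \<Psi> (fst w, snd w, t) * f t \<partial>lborel) ^ 4) \<partial>?L2)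
      \<le> ennreal (C * lam powr (-3/2)) * (\<integral>\<^sup>+t. ennreal (cmod (f t) ^ 4) \<partial>lborel)"
    show thesis
    proof (rule that)
      show "0 \<le> 1 / \<bar>?D\<bar> * C" using C by simp
    next
      fix lam :: real and f :: "real \<Rightarrow> complex"
      assume lam: "0 < lam" and f [measurable]: "f \<in> borel_measurable borel"
        and fin: "(\<integral>\<^sup>+t. ennreal (cmod (f t) ^ 4) \<partial>lborel) < \<infinity>"
      define G where "G = (\<lambda>w. ennreal (cmod (\<integral>t. exp (\<i> * complex_of_real (lam * (fst w * t\<^sup>2 + (snd w)\<^sup>2 * t))) * \<Psi> (fst w, snd w, t) * f t \<partial>lborel) ^ 4))"
      have "continuous_on UNIV \<Psi>"
        unfolding \<Psi>_def by (intro continuous_on_compose continuous_on_subset[OF smooth_imp_continuous[OF \<psi>(1)]] L_cont) auto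
      then have [measurable]: "\<Psi> \<in> borel_measurable (borel \<Otimes>\<^sub>M borel \<Otimes>\<^sub>M borel)"
        using borel_measurable_continuous_onI by (metis borel_prod)
      have G: "G \<in> borel_measurable (borel \<Otimes>\<^sub>M borel)"
        unfolding G_def by measurable
      have "(\<integral>\<^sup>+z. ennreal (cmod (\<integral>t. exp (\<i> * complex_of_real (lam * ((a * fst z + b * snd z) * t\<^sup>2 + (c * fst z + d * snd z)\<^sup>2 * t)))
         * \<psi> (fst z, snd z, t) * f t \<partial>lborel) ^ 4) \<partial>?L2)
        = (\<integral>\<^sup>+z. G (a * fst z + b * snd z, c * fst z + d * snd z) \<partial>?L2)"
        by (simp add: G_def \<Psi>_def L_inv)
      also have "\<dots> = ennreal (1 / \<bar>?D\<bar>) * (\<integral>\<^sup>+z. G z \<partial>?L2)"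
        by (rule nn_integral_linear_change2[OF G D])
      also have "\<dots> \<le> ennreal (1 / \<bar>?D\<bar>) * (ennreal (C * lam powr (-3/2)) * (\<integral>\<^sup>+t. ennreal (cmod (f t) ^ 4) \<partial>lborel))"
        unfolding G_def by (intro mult_left_mono C(2) lam f fin) auto
      also have "\<dots> = ennreal (1 / \<bar>?D\<bar> * C * lam powr (-3/2)) * (\<integral>\<^sup>+t. ennreal (cmod (f t) ^ 4) \<partial>lborel)"
        using C(1) by (subst mult.assoc[symmetric], subst ennreal_mult[symmetric]) (simp_all add: mult.assoc)
      finally show "(\<integral>\<^sup>+z. ennreal (cmod (\<integral>t. exp (\<i> * complex_of_real (lam * ((a * fst z + b * snd z) * t\<^sup>2 + (c * fst z + d * snd z)\<^sup>2 * t)))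
         * \<psi> (fst z, snd z, t) * f t \<partial>lborel) ^ 4) \<partial>?L2)
        \<le> ennreal (1 / \<bar>?D\<bar> * C * lam powr (-3/2)) * (\<integral>\<^sup>+t. ennreal (cmod (f t) ^ 4) \<partial>lborel)" .
    qed
  qed
qed

section \<open>A smooth bump function\<close>

lemma Ck_SucI:
  assumes "\<And>x. (f has_derivative f' x) (at x)" "\<And>v. Ck k (\<lambda>x. f' x v)"
  shows "Ck (Suc k) f"
proof -
  have "frechet_derivative f (at x) = f' x" for x
    using frechet_derivative_at[OF assms(1)] by simp
  then show ?thesis using assms by (auto simp: differentiable_def)
qed

lemma Ck_Suc_imp: "Ck (Suc k) f \<Longrightarrow> Ck k f"
proof (induction k arbitrary: f)
  case 0
  then show ?case
    by (auto simp: continuous_on_eq_continuous_within intro: differentiable_imp_continuous_within)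
next
  case (Suc k)
  then show ?case by (metis Ck.simps(2))
qed

lemma Ck_SucE:
  assumes "Ck (Suc k) f"
  shows "(f has_derivative frechet_derivative f (at x)) (at x)" "Ck k (\<lambda>x. frechet_derivative f (at x) v)"
proof -
  have "f differentiable (at x)" using assms by simp
  then show "(f has_derivative frechet_derivative f (at x)) (at x)"
    by (rule frechet_derivative_works[THEN iffD1])
  show "Ck k (\<lambda>x. frechet_derivative f (at x) v)" using assms by simp
qed

lemma Ck_add: "Ck k f \<Longrightarrow> Ck k g \<Longrightarrow> Ck k (\<lambda>x. f x + g x)"
proof (induction k arbitrary: f g)
  case 0
  then show ?case by (auto intro: continuous_intros)
next
  case (Suc k)
  show ?case
    by (rule Ck_SucI[OF has_derivative_add[OF Ck_SucE(1)[OF Suc.prems(1)] Ck_SucE(1)[OF Suc.prems(2)]]])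
       (intro Suc.IH Ck_SucE(2) Suc.prems)
qed

lemma Ck_mult:
  fixes f g :: "'a::euclidean_space \<Rightarrow> 'b::real_normed_algebra"
  shows "Ck k f \<Longrightarrow> Ck k g \<Longrightarrow> Ck k (\<lambda>x. f x * g x)"
proof (induction k arbitrary: f g)
  case 0
  then show ?case by (auto intro: continuous_intros)
next
  case (Suc k)
  show ?case
    by (rule Ck_SucI[OF has_derivative_mult[OF Ck_SucE(1)[OF Suc.prems(1)] Ck_SucE(1)[OF Suc.prems(2)]]])
       (intro Ck_add Suc.IH Ck_SucE(2) Suc.prems Suc.prems[THEN Ck_Suc_imp])
qed

lemma Ck_const: "Ck k (\<lambda>_. c)"
proof (induction k arbitrary: c)
  case (Suc k)
  show ?case by (rule Ck_SucI[OF has_derivative_const]) (rule Suc.IH)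
qed (simp add: continuous_on_const)

lemma Ck_linear_functional: "Ck k (\<lambda>x. complex_of_real (x \<bullet> v))"
proof (cases k)
  case 0
  then show ?thesis by (auto intro: continuous_intros)
next
  case (Suc m)
  have "((\<lambda>x. complex_of_real (x \<bullet> v)) has_derivative (\<lambda>h. complex_of_real (h \<bullet> v))) (at x)" for x
    by (intro has_derivative_of_real has_derivative_inner_left has_derivative_ident)
  then show ?thesis unfolding Suc by (rule Ck_SucI) (rule Ck_const)
qed

text \<open>The case n = 0 is the classical smooth function that is flat at 0. The powers of 1 / r
  make the linear span of the family closed under differentiation, so smoothness can be proved for
  all n at once.\<close>

definition flat :: "nat \<Rightarrow> real \<Rightarrow> real" where
  "flat n r = (if 0 < r then exp (- 1 / r) / r ^ n else 0)"

text \<open>With y = 1 / r, a single term of the exponential series gives y^(n+1) / (n+1)! <= exp y.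
  One power more than \<open>flat n\<close> contains leaves the factor r.\<close>

lemma flat_bound: "\<bar>flat n r\<bar> \<le> fact (Suc n) * \<bar>r\<bar>"
proof (cases "0 < r")
  case True
  define y where "y = 1 / r"
  have y: "0 < y" using True by (simp add: y_def)
  have "(\<Sum>i\<in>{Suc n}. y ^ i /\<^sub>R fact i) \<le> (\<Sum>i. y ^ i /\<^sub>R fact i)"
    using y by (intro sum_le_suminf summable_exp_generic) auto
  then have "y ^ Suc n / fact (Suc n) \<le> exp y"
    by (simp add: exp_def scaleR_conv_of_real divide_inverse mult.commute)
  then have "y ^ Suc n \<le> fact (Suc n) * exp y"
    by (simp add: pos_divide_le_eq mult.commute del: fact_Suc)
  then have "y ^ Suc n * exp (- y) \<le> (fact (Suc n) * exp y) * exp (- y)"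
    by (rule mult_right_mono) simp
  also have "\<dots> = fact (Suc n)" by (simp add: mult.assoc flip: exp_add)
  finally have le: "y ^ Suc n * exp (- y) \<le> fact (Suc n)" .
  have "\<bar>flat n r\<bar> = y ^ Suc n * exp (- y) * r"
    using True by (simp add: flat_def y_def power_divide)
  also have "\<dots> \<le> fact (Suc n) * r" using True by (intro mult_right_mono le) simp
  finally show ?thesis using True by (simp del: fact_Suc)
next
  case False
  have "0 \<le> fact (Suc n) * \<bar>r\<bar>" by (rule mult_nonneg_nonneg) auto
  then show ?thesis using False by (simp only: flat_def if_False abs_zero)
qed

lemma flat_has_derivative: "(flat n has_real_derivative (flat (n + 2) r - real n * flat (n + 1) r)) (at r)"
proof -
  consider "0 < r" | "r < 0" | "r = 0" by linarith
  then show ?thesis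
  proof cases
    case 1
    have P: "\<forall>m. m = 0 \<or> r ^ m = r * r ^ (m - Suc 0)"
      by (auto simp: power_eq_if)
    have "((\<lambda>r. exp (- 1 / r) / r ^ n) has_real_derivative (flat (n + 2) r - real n * flat (n + 1) r)) (at r)"
      using 1 P by (cases n) (auto intro!: derivative_eq_intros simp: flat_def divide_simps power2_eq_square algebra_simps)
    moreover have "\<forall>\<^sub>F x in nhds r. flat n x = exp (- 1 / x) / x ^ n"
      using 1 by (intro eventually_nhds_in_open[of "{0<..}", THEN eventually_mono]) (auto simp: flat_def)
    ultimately show ?thesis by (subst DERIV_cong_ev[OF refl _ refl]) auto
  next
    case 2
    have "\<forall>\<^sub>F x in nhds r. flat n x = 0"
      using 2 by (intro eventually_nhds_in_open[of "{..<0}", THEN eventually_mono]) (auto simp: flat_def)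
    then show ?thesis using 2 by (subst DERIV_cong_ev[OF refl _ refl, where g = "\<lambda>_. 0"]) (auto simp: flat_def)
  next
    case 3
    \<comment> \<open>The difference quotient at 0 is \<open>flat (Suc n) h\<close>, so
      \<open>flat_bound\<close> for \<open>Suc n\<close> makes it O(|h|).\<close>
    have "((\<lambda>h. (flat n (0 + h) - flat n 0) / h) \<longlongrightarrow> 0) (at 0)"
    proof (rule Lim_null_comparison)
      have "norm ((flat n (0 + h) - flat n 0) / h) \<le> fact (Suc (Suc n)) * \<bar>h\<bar>" for h
        using flat_bound[of "Suc n" h] by (auto simp: flat_def mult.commute simp del: fact_Suc split: if_splits)
      then show "\<forall>\<^sub>F h in at 0. norm ((flat n (0 + h) - flat n 0) / h) \<le> fact (Suc (Suc n)) * \<bar>h\<bar>"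
        by (intro always_eventually) blast
      show "((\<lambda>h. fact (Suc (Suc n)) * \<bar>h\<bar>) \<longlongrightarrow> 0) (at (0::real))"
        by (intro tendsto_mult_right_zero tendsto_rabs_zero tendsto_ident_at)
    qed
    then show ?thesis using 3 by (simp add: DERIV_def flat_def)
  qed
qed

text \<open>The induction on k keeps n arbitrary, because differentiation raises n by 1 and 2. The
  remaining factors of the derivative are linear or constant in x.\<close>

lemma Ck_bump:
  fixes K :: real
  shows "Ck k (\<lambda>x :: 'a::euclidean_space. complex_of_real (flat n (K - x \<bullet> x)))"
proof (induction k arbitrary: n)
  case 0
  have "continuous_on UNIV (flat n)"
    by (intro continuous_at_imp_continuous_on ballI DERIV_isCont[OF flat_has_derivative])
  then have "continuous_on UNIV (\<lambda>x::'a. flat n (K - x \<bullet> x))"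
    by (rule continuous_on_compose2) (auto intro!: continuous_intros)
  then show ?case by (auto intro: continuous_intros)
next
  case (Suc k)
  let ?f' = "\<lambda>x v :: 'a. (- 2) * complex_of_real (x \<bullet> v) *
     (complex_of_real (flat (n + 2) (K - x \<bullet> x)) + (- of_nat n) * complex_of_real (flat (n + 1) (K - x \<bullet> x)))"
  show ?case
  proof (rule Ck_SucI)
    fix x :: 'a
    have "((\<lambda>x. K - x \<bullet> x) has_derivative (\<lambda>v. - 2 * (x \<bullet> v))) (at x)"
      by (auto intro!: derivative_eq_intros simp: inner_commute)
    from has_derivative_compose[OF this has_field_derivative_imp_has_derivative[OF flat_has_derivative]]
    have "((\<lambda>x. flat n (K - x \<bullet> x)) has_derivative (\<lambda>v. (flat (n + 2) (K - x \<bullet> x) - real n * flat (n + 1) (K - x \<bullet> x)) * (- 2 * (x \<bullet> v)))) (at x)" .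
    from has_derivative_of_real[OF this, where 'a = complex]
    show "((\<lambda>x. complex_of_real (flat n (K - x \<bullet> x))) has_derivative ?f' x) (at x)"
      by (rule has_derivative_eq_rhs) (auto simp: fun_eq_iff algebra_simps)
  next
    fix v :: 'a
    show "Ck k (\<lambda>x. ?f' x v)"
      by (intro Ck_mult Ck_add Ck_const Ck_linear_functional Suc.IH)
  qed
qed

lemma bump_compactly_supported:
  "compactly_supported (\<lambda>x :: 'a::euclidean_space. complex_of_real (flat n (K - x \<bullet> x)))"
proof -
  have "{x :: 'a. complex_of_real (flat n (K - x \<bullet> x)) \<noteq> 0} \<subseteq> cball 0 (sqrt K)"
  proof
    fix x :: 'a
    assume "x \<in> {x. complex_of_real (flat n (K - x \<bullet> x)) \<noteq> 0}"
    then have "x \<bullet> x \<le> K" by (simp add: flat_def split: if_splits)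
    then show "x \<in> cball 0 (sqrt K)" by (simp add: norm_eq_sqrt_inner)
  qed
  then show ?thesis
    unfolding compactly_supported_def compact_closure by (rule bounded_subset[OF bounded_cball])
qed

section \<open>The two estimates\<close>

text \<open>Passes from \<open>Lp_space\<close>, defined with Lebesgue measurable functions, to
  Borel representatives, for which joint measurability on product spaces is available.\<close>

lemma lebesgue_complex_eq_borel_AE:
  fixes f :: "real \<Rightarrow> complex"
  assumes [measurable]: "f \<in> borel_measurable lebesgue"
  obtains g where "g \<in> borel_measurable borel" "AE x in lebesgue. f x = g x"
proof -
  have "(\<lambda>x. Re (f x)) \<in> borel_measurable (completion lborel)" "(\<lambda>x. Im (f x)) \<in> borel_measurable (completion lborel)"
    by measurable
  from this[THEN completion_ex_borel_measurable_real]
  obtain g1 g2 where [measurable]: "g1 \<in> borel_measurable lborel" "g2 \<in> borel_measurable lborel"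
    and ae: "AE x in lborel. Re (f x) = g1 x" "AE x in lborel. Im (f x) = g2 x" by blast
  show thesis
  proof
    show "(\<lambda>x. Complex (g1 x) (g2 x)) \<in> borel_measurable borel"
      unfolding Complex_eq by measurable
    have "AE x in lborel. f x = Complex (g1 x) (g2 x)"
      using ae by eventually_elim (simp add: complex_eq_iff)
    then show "AE x in lebesgue. f x = Complex (g1 x) (g2 x)" by (rule AE_completion)
  qed
qed

lemma powr_4_eq: "0 \<le> x \<Longrightarrow> x powr 4 = x ^ 4" for x :: real
  by (rule powr_numeral)

lemma L4_fromI:
  fixes F :: "real \<times> real \<Rightarrow> complex"
  assumes F: "F \<in> borel_measurable borel"
    and le: "(\<integral>\<^sup>+z. ennreal (cmod (F z) ^ 4) \<partial>lborel) \<le> ennreal r" and r: "0 \<le> r"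
  shows "F \<in> Lp_space 4" "Lp_norm 4 F \<le> r powr (1/4)"
proof -
  have int: "integrable lborel (\<lambda>z. cmod (F z) powr 4)"
    using F le by (intro integrableI_bounded) (auto simp: powr_4_eq intro: le_less_trans)
  then show "F \<in> Lp_space 4"
    using F by (simp add: Lp_space_def integrable_completion measurable_completion)
  have "ennreal (\<integral>z. cmod (F z) powr 4 \<partial>lborel) = (\<integral>\<^sup>+z. ennreal (cmod (F z) powr 4) \<partial>lborel)"
    using int by (intro nn_integral_eq_integral[symmetric]) auto
  also have "\<dots> \<le> ennreal r" using le by (simp add: powr_4_eq)
  finally have "(\<integral>z. cmod (F z) powr 4 \<partial>lborel) \<le> r" using r by simp
  moreover have "(\<integral>z. cmod (F z) powr 4 \<partial>lebesgue) = (\<integral>z. cmod (F z) powr 4 \<partial>lborel)"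
    using F by (intro integral_completion) auto
  ultimately show "Lp_norm 4 F \<le> r powr (1/4)"
    unfolding Lp_norm_def by (intro powr_mono2) (auto intro: integral_nonneg_AE)
qed

lemma T_op_upper_bound:
  fixes a b c d :: real and \<psi> :: "real \<times> real \<times> real \<Rightarrow> complex"
  assumes D: "a * d - b * c \<noteq> 0" and \<psi>: "smooth \<psi>" "compactly_supported \<psi>"
  shows "\<exists>C. \<forall>lam > 0. \<forall>f \<in> Lp_space 4. T_op a b c d \<psi> lam f \<in> Lp_space 4 \<and>
     Lp_norm 4 (T_op a b c d \<psi> lam f) \<le> C * lam powr (- 3 / 8) * Lp_norm 4 f"
proof (rule T_op_straight_bound[OF D \<psi>])
  fix C assume C: "0 \<le> C" "\<And>lam f. 0 < lam \<Longrightarrow> f \<in> borel_measurable borel \<Longrightarrow>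
      (\<integral>\<^sup>+t. ennreal (cmod (f t) ^ 4) \<partial>lborel) < \<infinity> \<Longrightarrow>
      (\<integral>\<^sup>+z. ennreal (cmod (\<integral>t. exp (\<i> * complex_of_real (lam * ((a * fst z + b * snd z) * t\<^sup>2 + (c * fst z + d * snd z)\<^sup>2 * t)))
         * \<psi> (fst z, snd z, t) * f t \<partial>lborel) ^ 4) \<partial>(lborel \<Otimes>\<^sub>M lborel))
      \<le> ennreal (C * lam powr (-3/2)) * (\<integral>\<^sup>+t. ennreal (cmod (f t) ^ 4) \<partial>lborel)"
  have \<psi>_meas [measurable]: "\<psi> \<in> borel_measurable (borel \<Otimes>\<^sub>M borel \<Otimes>\<^sub>M borel)"
    using borel_measurable_continuous_onI[OF smooth_imp_continuous[OF \<psi>(1)]] by (simp add: borel_prod)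
  have "T_op a b c d \<psi> lam f \<in> Lp_space 4 \<and>
     Lp_norm 4 (T_op a b c d \<psi> lam f) \<le> C powr (1/4) * lam powr (- 3 / 8) * Lp_norm 4 f"
    if lam: "0 < lam" and f: "f \<in> Lp_space 4" for lam :: real and f :: "real \<Rightarrow> complex"
  proof -
    have f_meas [measurable]: "f \<in> borel_measurable lebesgue" and f_int: "integrable lebesgue (\<lambda>x. cmod (f x) powr 4)"
      using f by (auto simp: Lp_space_def)
    obtain g where g [measurable]: "g \<in> borel_measurable borel" and ae: "AE x in lebesgue. f x = g x"
      using lebesgue_complex_eq_borel_AE[OF f_meas] .
    have g_leb [measurable]: "g \<in> borel_measurable lebesgue" using g by (simp add: measurable_completion)
    define N where "N = (\<integral>x. cmod (f x) powr 4 \<partial>lebesgue)"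
    have N: "0 \<le> N" unfolding N_def by (rule integral_nonneg_AE) simp
    have gN: "(\<integral>\<^sup>+t. ennreal (cmod (g t) ^ 4) \<partial>lborel) = ennreal N"
    proof -
      have "(\<integral>\<^sup>+t. ennreal (cmod (g t) ^ 4) \<partial>lborel) = (\<integral>\<^sup>+t. ennreal (cmod (g t) ^ 4) \<partial>lebesgue)"
        by (rule nn_integral_completion[symmetric])
      also have "\<dots> = (\<integral>\<^sup>+t. ennreal (cmod (f t) powr 4) \<partial>lebesgue)"
        using ae by (intro nn_integral_cong_AE) (auto simp: powr_4_eq)
      also have "\<dots> = ennreal N"
        unfolding N_def by (rule nn_integral_eq_integral[OF f_int]) simp
      finally show ?thesis .
    qed
    let ?T = "\<lambda>z. \<integral>t. exp (\<i> * complex_of_real (lam * ((a * fst z + b * snd z) * t\<^sup>2 + (c * fst z + d * snd z)\<^sup>2 * t)))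
         * \<psi> (fst z, snd z, t) * g t \<partial>lborel"
    \<comment> \<open>Equality holds at every point and not just almost everywhere: for each z,
      altering f on a null set leaves the integral over t unchanged.\<close>
    have T: "T_op a b c d \<psi> lam f = ?T"
    proof
      fix z :: "real \<times> real"
      define k where "k = (\<lambda>t. exp (\<i> * complex_of_real (lam * ((a * fst z + b * snd z) * t\<^sup>2 + (c * fst z + d * snd z)\<^sup>2 * t))) * \<psi> (fst z, snd z, t))"
      have k [measurable]: "k \<in> borel_measurable borel"
        unfolding k_def by measurable
      then have [measurable]: "k \<in> borel_measurable lebesgue"
        by (simp add: measurable_completion)
      have "T_op a b c d \<psi> lam f z = (\<integral>t. k t * f t \<partial>lebesgue)"
        by (simp add: T_op_def k_def case_prod_unfold)
      also have "\<dots> = (\<integral>t. k t * g t \<partial>lebesgue)"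
        using ae by (intro integral_cong_AE) auto
      also have "\<dots> = (\<integral>t. k t * g t \<partial>lborel)"
        by (rule integral_completion) measurable
      also have "\<dots> = ?T z" by (simp add: k_def)
      finally show "T_op a b c d \<psi> lam f z = ?T z" .
    qed
    have T_meas: "?T \<in> borel_measurable borel"
    proof -
      have "?T \<in> borel_measurable (borel \<Otimes>\<^sub>M borel)" by measurable
      then show ?thesis by (simp add: borel_prod)
    qed
    have le: "(\<integral>\<^sup>+z. ennreal (cmod (?T z) ^ 4) \<partial>lborel) \<le> ennreal (C * lam powr (-3/2) * N)"
    proof -
      have "(\<integral>\<^sup>+z. ennreal (cmod (?T z) ^ 4) \<partial>lborel) = (\<integral>\<^sup>+z. ennreal (cmod (?T z) ^ 4) \<partial>(lborel \<Otimes>\<^sub>M lborel))"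
        by (simp only: lborel_prod)
      also have "\<dots> \<le> ennreal (C * lam powr (-3/2)) * (\<integral>\<^sup>+t. ennreal (cmod (g t) ^ 4) \<partial>lborel)"
        by (rule C(2)[OF lam g]) (simp add: gN)
      also have "\<dots> = ennreal (C * lam powr (-3/2) * N)"
        unfolding gN using C(1) N by (intro ennreal_mult[symmetric]) auto
      finally show ?thesis .
    qed
    have nonneg: "0 \<le> C * lam powr (-3/2) * N" using C(1) N by simp
    have "(C * lam powr (-3/2) * N) powr (1/4) = C powr (1/4) * lam powr (- 3 / 8) * Lp_norm 4 f"
      using C(1) N by (simp add: powr_mult powr_powr Lp_norm_def N_def)
    then show ?thesis
      unfolding T using L4_fromI[OF T_meas le nonneg] by simp
  qed
  then show ?thesis by blast
qed

section \<open>The lower bound and the optimal exponent\<close>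

lemma cos_ge_half: "\<bar>x\<bar> \<le> 1 \<Longrightarrow> 1 / 2 \<le> cos x" for x :: real
proof -
  assume x: "\<bar>x\<bar> \<le> 1"
  have "cos x = 1 - 2 * (sin (x / 2))\<^sup>2" using cos_double_sin[of "x / 2"] by simp
  moreover have "\<bar>sin (x / 2)\<bar> \<le> 1 / 2" using abs_sin_x_le_abs_x[of "x / 2"] x by simp
  then have "\<bar>sin (x / 2)\<bar>\<^sup>2 \<le> (1 / 2)\<^sup>2" by (intro power_mono) auto
  ultimately show ?thesis by (simp add: power2_eq_square)
qed

text \<open>On the non-oscillating set the real part of the integrand is bounded below, so |T f| is
  too, and the measure of that set gives the decay. Membership in \<open>Lp_space\<close> is a
  premise of the last clause because otherwise the Bochner integral in \<open>Lp_norm\<close> would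
  be 0; in the sharpness statement the assumed estimate supplies it.\<close>

lemma T_op_lower_bound:
  fixes a b c d :: real
  assumes D: "a * d - b * c \<noteq> 0"
  obtains \<psi> :: "real \<times> real \<times> real \<Rightarrow> complex" and \<kappa> :: real
  where "smooth \<psi>" "compactly_supported \<psi>" "0 < \<kappa>"
    "\<And>lam. 1 \<le> lam \<Longrightarrow> T_op a b c d \<psi> lam (indicator {0..1}) \<in> Lp_space 4 \<Longrightarrow>
       \<kappa> * lam powr (- 3 / 8) \<le> Lp_norm 4 (T_op a b c d \<psi> lam (indicator {0..1}))"
proof -
  let ?D = "a * d - b * c"
  let ?L2 = "lborel \<Otimes>\<^sub>M lborel :: (real \<times> real) measure"
  \<comment> \<open>By Cramer's rule M bounds |x| and |y| whenever |u|, |v| <= 1.\<close>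
  define M where "M = (\<bar>a\<bar> + \<bar>b\<bar> + \<bar>c\<bar> + \<bar>d\<bar>) / \<bar>?D\<bar>"
  \<comment> \<open>For |x|, |y| <= M and t in [0, 1] this leaves K - (x^2 + y^2 + t^2) >= 1, so the
    bump is at least exp(-1) there.\<close>
  define K where "K = 2 * M\<^sup>2 + 2"
  define \<psi> where "\<psi> = (\<lambda>x :: real \<times> real \<times> real. complex_of_real (flat 0 (K - x \<bullet> x)))"
  have sm: "smooth \<psi>" unfolding smooth_def \<psi>_def using Ck_bump by blast
  have cs: "compactly_supported \<psi>" unfolding \<psi>_def by (rule bump_compactly_supported)
  \<comment> \<open>exp(-1) bounds the amplitude from below, and 1/2 bounds the cosine of a phase of
    modulus at most 1.\<close>
  define \<kappa>0 where "\<kappa>0 = exp (- 1) / (2::real)"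
  have \<kappa>0: "0 < \<kappa>0" by (simp add: \<kappa>0_def)
  have bound: "\<kappa>0 \<le> cmod (T_op a b c d \<psi> lam (indicator {0..1}) (x, y))"
    if lam: "1 \<le> lam" and u: "\<bar>a * x + b * y\<bar> \<le> 1 / (2 * lam)" and v: "\<bar>c * x + d * y\<bar> \<le> 1 / sqrt (2 * lam)" for lam x y
  proof -
    define u v where "u = a * x + b * y" and "v = c * x + d * y"
    have u1: "\<bar>u\<bar> \<le> 1 / (2 * lam)" and v1: "v\<^sup>2 \<le> 1 / (2 * lam)"
    proof -
      have "\<bar>v\<bar>\<^sup>2 \<le> (1 / sqrt (2 * lam))\<^sup>2" using v by (intro power_mono) (auto simp: v_def)
      then show "v\<^sup>2 \<le> 1 / (2 * lam)" using lam by (simp add: power_divide)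
    qed (use u in \<open>simp add: u_def\<close>)
    have "1 / (2 * lam) \<le> 1" using lam by simp
    then have "\<bar>u\<bar> \<le> 1" "v\<^sup>2 \<le> 1"
      using u1 v1 by (blast intro: order_trans)+
    then have uv1: "\<bar>u\<bar> \<le> 1" "\<bar>v\<bar> \<le> 1"
      by (simp_all only: abs_square_le_1)
    have xD: "x * ?D = d * u - b * v" "y * ?D = a * v - c * u"
      by (simp_all add: u_def v_def algebra_simps)
    have "\<bar>x\<bar> * \<bar>?D\<bar> \<le> \<bar>a\<bar> + \<bar>b\<bar> + \<bar>c\<bar> + \<bar>d\<bar>" "\<bar>y\<bar> * \<bar>?D\<bar> \<le> \<bar>a\<bar> + \<bar>b\<bar> + \<bar>c\<bar> + \<bar>d\<bar>"
    proof -
      have m: "\<bar>p * w\<bar> \<le> \<bar>p\<bar>" if "\<bar>w\<bar> \<le> 1" for p w :: real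
        using mult_left_mono[OF that, of "\<bar>p\<bar>"] by (simp add: abs_mult)
      have "\<bar>d * u - b * v\<bar> \<le> \<bar>d\<bar> + \<bar>b\<bar>" "\<bar>a * v - c * u\<bar> \<le> \<bar>a\<bar> + \<bar>c\<bar>"
        by (rule order_trans[OF abs_triangle_ineq4], intro add_mono m uv1)+
      then show "\<bar>x\<bar> * \<bar>?D\<bar> \<le> \<bar>a\<bar> + \<bar>b\<bar> + \<bar>c\<bar> + \<bar>d\<bar>" "\<bar>y\<bar> * \<bar>?D\<bar> \<le> \<bar>a\<bar> + \<bar>b\<bar> + \<bar>c\<bar> + \<bar>d\<bar>"
        unfolding abs_mult[symmetric] xD
        using abs_ge_zero[of a] abs_ge_zero[of b] abs_ge_zero[of c] abs_ge_zero[of d] by linarith+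
    qed
    then have xyM: "\<bar>x\<bar> \<le> M" "\<bar>y\<bar> \<le> M" using D by (simp_all add: M_def pos_le_divide_eq)
    define p where "p = (\<lambda>t::real. flat 0 (K - (x, y, t) \<bullet> (x, y, t)))"
    have p_ge: "exp (- 1) \<le> p t" if t: "t \<in> {0..1}" for t
    proof -
      have "x\<^sup>2 \<le> M\<^sup>2" "y\<^sup>2 \<le> M\<^sup>2" using power_mono[OF xyM(1), of 2] power_mono[OF xyM(2), of 2] by simp_all
      moreover have "t\<^sup>2 \<le> 1" using t by (simp add: power_le_one)
      ultimately have r: "1 \<le> K - (x, y, t) \<bullet> (x, y, t)" by (simp add: K_def power2_eq_square)
      then have "1 / (K - (x, y, t) \<bullet> (x, y, t)) \<le> 1" by simp
      then show ?thesis using r by (simp add: p_def flat_def)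
    qed
    have p_cont: "continuous_on UNIV p"
    proof -
      have "continuous_on UNIV (flat 0)"
        by (intro continuous_at_imp_continuous_on ballI DERIV_isCont[OF flat_has_derivative])
      then show ?thesis unfolding p_def by (rule continuous_on_compose2) (auto intro!: continuous_intros)
    qed
    let ?\<theta> = "\<lambda>t. lam * (u * t\<^sup>2 + v\<^sup>2 * t)"
    have \<theta>: "\<bar>?\<theta> t\<bar> \<le> 1" if t: "t \<in> {0..1}" for t
    proof -
      have "\<bar>u * t\<^sup>2 + v\<^sup>2 * t\<bar> \<le> \<bar>u\<bar> * \<bar>t\<^sup>2\<bar> + v\<^sup>2 * \<bar>t\<bar>"
        using abs_triangle_ineq[of "u * t\<^sup>2" "v\<^sup>2 * t"] by (simp add: abs_mult)
      also have "\<dots> \<le> 1 / (2 * lam) * 1 + 1 / (2 * lam) * 1"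
        using t lam by (intro add_mono mult_mono u1 v1) (auto simp: power_le_one)
      also have "\<dots> = 1 / lam" using lam by (simp add: field_simps)
      finally have "lam * \<bar>u * t\<^sup>2 + v\<^sup>2 * t\<bar> \<le> lam * (1 / lam)" using lam by (intro mult_left_mono) auto
      then show ?thesis using lam by (simp add: abs_mult)
    qed
    let ?F = "\<lambda>t. exp (\<i> * complex_of_real (?\<theta> t)) * complex_of_real (p t)"
    have F_cont: "continuous_on {0..1} ?F"
      by (intro continuous_intros continuous_on_subset[OF p_cont]) auto
    have F_int: "integrable lborel (\<lambda>t. indicator {0..1} t *\<^sub>R ?F t)"
      using F_cont by (intro borel_integrable_compact) auto
    have "T_op a b c d \<psi> lam (indicator {0..1}) (x, y) = (\<integral>t. indicator {0..1} t *\<^sub>R ?F t \<partial>lebesgue)"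
      unfolding T_op_def prod.case
      by (intro Bochner_Integration.integral_cong) (auto simp: u_def v_def \<psi>_def p_def indicator_def)
    also have "\<dots> = (\<integral>t. indicator {0..1} t *\<^sub>R ?F t \<partial>lborel)"
      by (rule integral_completion) (use F_int in auto)
    finally have "Re (T_op a b c d \<psi> lam (indicator {0..1}) (x, y)) = (\<integral>t. indicator {0..1} t * (cos (?\<theta> t) * p t) \<partial>lborel)"
      using integral_Re[OF F_int] by (simp add: Re_exp)
    moreover have "(\<integral>t. indicator {0..1::real} t * \<kappa>0 \<partial>lborel) \<le> (\<integral>t. indicator {0..1} t * (cos (?\<theta> t) * p t) \<partial>lborel)"
    proof (rule integral_mono)
      show "integrable lborel (\<lambda>t. indicator {0..1::real} t * \<kappa>0)"
        by (intro integrable_mult_left integrable_real_indicator) auto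
      show "integrable lborel (\<lambda>t. indicator {0..1} t * (cos (?\<theta> t) * p t))"
        using integrable_Re[OF F_int] by (simp add: Re_exp)
      show "indicator {0..1} t * \<kappa>0 \<le> indicator {0..1} t * (cos (?\<theta> t) * p t)" for t
      proof (cases "t \<in> {0..1}")
        case True
        have "1 / 2 * exp (- 1) \<le> cos (?\<theta> t) * p t"
          using cos_ge_half[OF \<theta>[OF True]] p_ge[OF True] by (intro mult_mono) auto
        then show ?thesis using True by (simp add: \<kappa>0_def)
      qed simp
    qed
    ultimately have "\<kappa>0 \<le> Re (T_op a b c d \<psi> lam (indicator {0..1}) (x, y))" by simp
    also have "\<dots> \<le> cmod (T_op a b c d \<psi> lam (indicator {0..1}) (x, y))" by (rule complex_Re_le_cmod)
    finally show ?thesis .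
  qed
  \<comment> \<open>The rectangle \<open>?Q\<close> below has area (1 / lam) (2 / sqrt(2 lam)) =
    sqrt 2 lam^(-3/2) in the coordinates (u, v); dividing by |D| gives the area in (x, y).\<close>
  define m where "m = \<kappa>0 ^ 4 * (sqrt 2 / \<bar>?D\<bar>)"
  have m: "0 < m" using \<kappa>0 D by (simp add: m_def)
  show thesis
  proof (rule that[OF sm cs])
    show "0 < m powr (1/4)" using m by simp
  next
    fix lam :: real
    assume lam: "1 \<le> lam" and T: "T_op a b c d \<psi> lam (indicator {0..1}) \<in> Lp_space 4"
    let ?T = "T_op a b c d \<psi> lam (indicator {0..1})"
    let ?Q = "{- (1 / (2 * lam))..1 / (2 * lam)} \<times> {- (1 / sqrt (2 * lam))..1 / sqrt (2 * lam)}"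
    let ?h = "\<lambda>w. ennreal (\<kappa>0 ^ 4) * indicator ?Q w"
    have "ennreal (m * lam powr (-3/2)) = ennreal (1 / \<bar>?D\<bar>) * (\<integral>\<^sup>+w. ?h w \<partial>?L2)"
    proof -
      have I: "(\<integral>\<^sup>+w. ?h w \<partial>?L2) = ennreal (\<kappa>0 ^ 4) * (ennreal (1 / lam) * ennreal (2 / sqrt (2 * lam)))"
        using lam by (subst nn_integral_cmult_indicator) (auto simp: lborel.emeasure_pair_measure_Times)
      have J: "m * lam powr (-3/2) = 1 / \<bar>?D\<bar> * (\<kappa>0 ^ 4 * (1 / lam * (2 / sqrt (2 * lam))))"
      proof -
        have "lam powr (-3/2) = 1 / (lam * sqrt lam)"
          using lam powr_add[of lam 1 "1/2"] by (simp add: powr_half_sqrt powr_minus_divide)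
        moreover have "2 / sqrt (2 * lam) = sqrt 2 / sqrt lam"
          by (simp add: real_sqrt_mult real_div_sqrt flip: divide_divide_eq_left)
        ultimately show ?thesis by (simp add: m_def)
      qed
      have P: "ennreal (p * (q * (r * s))) = ennreal p * (ennreal q * (ennreal r * ennreal s))"
        if "0 \<le> p" "0 \<le> q" "0 \<le> r" "0 \<le> s" for p q r s
        using that by (simp add: ennreal_mult)
      show ?thesis unfolding I J by (rule P) (use lam \<kappa>0 in auto)
    qed
    also have "\<dots> = (\<integral>\<^sup>+z. ?h (a * fst z + b * snd z, c * fst z + d * snd z) \<partial>?L2)"
      by (rule nn_integral_linear_change2[OF _ D, symmetric]) measurable
    also have "\<dots> \<le> (\<integral>\<^sup>+z. ennreal (cmod (?T z) powr 4) \<partial>?L2)"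
    proof (rule nn_integral_mono)
      fix z :: "real \<times> real"
      obtain x y where z: "z = (x, y)" by (cases z)
      show "?h (a * fst z + b * snd z, c * fst z + d * snd z) \<le> ennreal (cmod (?T z) powr 4)"
      proof (cases "(a * x + b * y, c * x + d * y) \<in> ?Q")
        case True
        then have "\<kappa>0 \<le> cmod (?T z)" unfolding z by (intro bound lam) (auto simp: abs_le_iff)
        then have "\<kappa>0 ^ 4 \<le> cmod (?T z) ^ 4" using \<kappa>0 by (intro power_mono) auto
        then show ?thesis using True by (simp add: z powr_4_eq ennreal_leI)
      qed (simp add: z)
    qed
    also have "\<dots> = (\<integral>\<^sup>+z. ennreal (cmod (?T z) powr 4) \<partial>lebesgue)"
      by (simp only: lborel_prod nn_integral_completion)
    also have "\<dots> = ennreal (\<integral>z. cmod (?T z) powr 4 \<partial>lebesgue)"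
      using T by (intro nn_integral_eq_integral) (auto simp: Lp_space_def)
    finally have le: "m * lam powr (-3/2) \<le> (\<integral>z. cmod (?T z) powr 4 \<partial>lebesgue)"
      by (subst (asm) ennreal_le_iff) (auto intro: integral_nonneg_AE)
    have "m powr (1/4) * lam powr (- 3 / 8) = (m * lam powr (-3/2)) powr (1/4)"
      using m by (simp add: powr_mult powr_powr)
    also have "\<dots> \<le> Lp_norm 4 ?T"
      unfolding Lp_norm_def using le m by (intro powr_mono2) auto
    finally show "m powr (1/4) * lam powr (- 3 / 8) \<le> Lp_norm 4 ?T" .
  qed
qed

lemma powr_exponent_le:
  fixes \<alpha> \<beta> \<kappa> C :: real
  assumes \<kappa>: "0 < \<kappa>" and le: "\<And>lam. 1 \<le> lam \<Longrightarrow> \<kappa> * lam powr (- \<alpha>) \<le> C * lam powr (- \<beta>)"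
  shows "\<beta> \<le> \<alpha>"
proof (rule ccontr)
  assume "\<not> \<beta> \<le> \<alpha>"
  then have pos: "0 < \<beta> - \<alpha>" by simp
  have "lam powr (\<beta> - \<alpha>) \<le> C / \<kappa>" if "1 \<le> lam" for lam
  proof -
    have "\<kappa> * lam powr (- \<alpha>) * lam powr \<beta> \<le> C * lam powr (- \<beta>) * lam powr \<beta>"
      by (intro mult_right_mono le that) auto
    then have "\<kappa> * lam powr (\<beta> - \<alpha>) \<le> C"
      using that by (simp add: mult.assoc powr_minus_divide powr_diff)
    then show ?thesis using \<kappa> by (simp add: pos_le_divide_eq mult.commute)
  qed
  then have *: "lam powr (\<beta> - \<alpha>) \<le> C / \<kappa>" if "1 \<le> lam" for lam using that by blast
  \<comment> \<open>The inequality is tested at lam = X^(1 / (beta - alpha)). This is at least 1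
    because X is, and its power is X > C / kappa.\<close>
  define X where "X = max 1 (C / \<kappa> + 1)"
  have "(X powr (1 / (\<beta> - \<alpha>))) powr (\<beta> - \<alpha>) \<le> C / \<kappa>"
    using pos by (intro *) (auto simp: X_def intro!: ge_one_powr_ge_zero)
  then have "X \<le> C / \<kappa>" using pos by (simp add: powr_powr X_def)
  then show False by (simp add: X_def)
qed

lemma indicator_in_Lp_space:
  "(indicator {0..1} :: real \<Rightarrow> complex) \<in> Lp_space 4" "Lp_norm 4 (indicator {0..1} :: real \<Rightarrow> complex) = 1"
proof -
  have eq: "(\<lambda>x. cmod (indicator {0..1::real} x) powr 4) = indicator {0..1}"
    by (auto simp: indicator_def)
  have "(indicator {0..1} :: real \<Rightarrow> complex) \<in> borel_measurable lebesgue"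
    by (rule measurable_completion) measurable
  then show "(indicator {0..1} :: real \<Rightarrow> complex) \<in> Lp_space 4"
    by (simp only: Lp_space_def mem_Collect_eq eq) (auto intro!: integrable_real_indicator)
  show "Lp_norm 4 (indicator {0..1} :: real \<Rightarrow> complex) = 1"
    by (simp only: Lp_norm_def eq) simp
qed

theorem corollary1p2:
  fixes a b c d :: real
  assumes "invertible (vector [vector [a, b], vector [c, d]] :: real^2^2)"
  shows
    "(\<forall>\<psi> :: real \<times> real \<times> real \<Rightarrow> complex. smooth \<psi> \<longrightarrow> compactly_supported \<psi> \<longrightarrow>
        (\<exists>C :: real. \<forall>lam > 0. \<forall>f \<in> Lp_space 4.
           T_op a b c d \<psi> lam f \<in> Lp_space 4 \<and>
           Lp_norm 4 (T_op a b c d \<psi> lam f) \<le> C * lam powr (- 3 / 8) * Lp_norm 4 f))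
     \<and> (\<forall>\<delta> :: real.
        (\<forall>\<psi> :: real \<times> real \<times> real \<Rightarrow> complex. smooth \<psi> \<longrightarrow> compactly_supported \<psi> \<longrightarrow>
          (\<exists>C :: real. \<forall>lam \<ge> 1. \<forall>f \<in> Lp_space 4.
             T_op a b c d \<psi> lam f \<in> Lp_space 4 \<and>
             Lp_norm 4 (T_op a b c d \<psi> lam f) \<le> C * lam powr (- \<delta>) * Lp_norm 4 f))
        \<longrightarrow> \<delta> \<le> 3 / 8)"
proof -
  have D: "a * d - b * c \<noteq> 0"
    using assms by (simp add: invertible_det_nz det_2)
  show ?thesis
  proof (intro conjI allI impI)
    fix \<psi> :: "real \<times> real \<times> real \<Rightarrow> complex"
    assume "smooth \<psi>" "compactly_supported \<psi>"
    then show "\<exists>C :: real. \<forall>lam > 0. \<forall>f \<in> Lp_space 4. T_op a b c d \<psi> lam f \<in> Lp_space 4 \<and>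
           Lp_norm 4 (T_op a b c d \<psi> lam f) \<le> C * lam powr (- 3 / 8) * Lp_norm 4 f"
      by (rule T_op_upper_bound[OF D])
  next
    fix \<delta> :: real
    assume H: "\<forall>\<psi> :: real \<times> real \<times> real \<Rightarrow> complex. smooth \<psi> \<longrightarrow> compactly_supported \<psi> \<longrightarrow>
          (\<exists>C :: real. \<forall>lam \<ge> 1. \<forall>f \<in> Lp_space 4.
             T_op a b c d \<psi> lam f \<in> Lp_space 4 \<and>
             Lp_norm 4 (T_op a b c d \<psi> lam f) \<le> C * lam powr (- \<delta>) * Lp_norm 4 f)"
    show "\<delta> \<le> 3 / 8"
    proof (rule T_op_lower_bound[OF D])
      fix \<psi> :: "real \<times> real \<times> real \<Rightarrow> complex" and \<kappa> :: real
      assume \<psi>: "smooth \<psi>" "compactly_supported \<psi>" and \<kappa>: "0 < \<kappa>"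
        and lower: "\<And>lam. 1 \<le> lam \<Longrightarrow> T_op a b c d \<psi> lam (indicator {0..1}) \<in> Lp_space 4 \<Longrightarrow>
          \<kappa> * lam powr (- 3 / 8) \<le> Lp_norm 4 (T_op a b c d \<psi> lam (indicator {0..1}))"
      from H \<psi> obtain C where C: "\<And>lam f. 1 \<le> lam \<Longrightarrow> f \<in> Lp_space 4 \<Longrightarrow>
          T_op a b c d \<psi> lam f \<in> Lp_space 4 \<and> Lp_norm 4 (T_op a b c d \<psi> lam f) \<le> C * lam powr (- \<delta>) * Lp_norm 4 f"
        by blast
      \<comment> \<open>The test function has norm 1, and the assumed estimate supplies the
        membership on which the lower bound is conditional.\<close>
      have "\<kappa> * lam powr (- (3 / 8)) \<le> C * lam powr (- \<delta>)" if lam: "1 \<le> lam" for lam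
        using lower[OF lam] C[OF lam indicator_in_Lp_space(1)] by (simp add: indicator_in_Lp_space(2))
      then show ?thesis by (rule powr_exponent_le[OF \<kappa>])
    qed
  qed
qed

end
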